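(* Consider a Morse spacetime that admits a local chart $(\mathbb{R}^4,h,f,\zeta=2)$, with coordinates $(x_1,x_2,y_1,y_2)$, where the metric is Euclidean, $h=\sum_{i=1}^2\left[(dx_i)^2+(dy_i)^2\right]$, and the Morse function is $$f=\tfrac12\left[-(x_1)^2-8(x_2)^2+(y_1)^2+(y_2)^2\right].$$ Then this spacetime is causally discontinuous (i.e. not causally continuous). More precisely, the points given in this chart by $$q=(\sqrt2+1,0,1,0),\qquad p=(-(\sqrt2-1),0,1,0)$$ are points of causal discontinuity.
   Context: A Morse spacetime $(M,h,f,\zeta)$ consists of a compact, connected smooth Riemannian manifold $(M,h)$, possibly with boundary, a Morse function $f:M\to\mathbb{R}$ (a smooth function whose critical points are all non-degenerate) without critical points on $\partial M$, and a real number $\zeta>1$. One also allows $M=\mathbb{R}^{k}$, with the assumption that all data are pullbacks along a smooth embedding into a compact manifold. That a Morse spacetime admits a local chart $(\mathbb{R}^4,h,f,\zeta=2)$ means that it has $\zeta=2$ and that around a critical point there is a chart with values in $\mathbb{R}^4$ (critical point at the origin) in which its Riemannian metric and Morse function are the given $h$ and $f$. The Morse–Lorentzian metric is the symmetric bilinear form field $g(z)=\|df(z)\|_h^2\,h(z)-\zeta\,df(z)\otimes df(z)$. It vanishes exactly at the critical points of $f$ and is Lorentzian elsewhere (since $\zeta>1$). At a non-critical point $z$, a tangent vector $v$ is timelike if $g(v,v)<0$; it is positively (future) oriented if moreover $df(v)>0$ and negatively (past) oriented if $df(v)<0$. (Equivalently, $v$ is positive timelike iff $v\neq0$ and its $h$-angle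 with $\nabla f$ is less than $\theta$, where $\theta\in(0,\pi/2)$ and $\cos\theta=\zeta^{-1/2}$, so $\theta=\pi/4$ for $\zeta=2$.) No vector at a critical point is timelike. A positive (negative) timelike curve is a regular curve avoiding the critical points whose velocity is positive (negative) timelike at every time. A broken positive (negative) timelike curve consists of pieces of positive (negative) timelike curves, where pieces are also allowed to start or end at a critical point and a piece that ends at a critical point may be followed by a next piece that starts at this critical point. The (broken) future $I^+(z)$ (past $I^-(z)$) is the set of points that can be reached from $z$ by a broken positive (negative) timelike curve. The spacetime is distinguishing if $I^+(p)=I^+(q)$ or $I^-(p)=I^-(q)$ implies $p=q$. It is reflecting if for all points $p,q$: $I^+(p)\subseteq I^+(q)\Leftrightarrow I^-(q)\subseteq I^-(p)$. It is causally continuous if it is distinguishing and reflecting. Two points $p,q$ are called points of causal discontinuity if they violate reflectivity, i.e. if the equivalence $I^+(p)\subseteq I^+(q)\Leftrightarrow I^-(q)\subseteq I^-(p)$ fails for them.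
   Formalization: The claim that p and q are points of causal discontinuity is proved for charts whose image contains the open ball of radius 3 about the origin; for a chart that merely contains p and q it can fail, since their causal relation may depend on data outside the chart. *)

theory Defs
  imports "HOL-Analysis.Analysis"
begin

section \<open>Smooth maps between subsets of Euclidean spaces\<close>

primrec Ck_on :: "nat \<Rightarrow> 'a::euclidean_space set \<Rightarrow> ('a \<Rightarrow> 'b::real_normed_vector) \<Rightarrow> bool" where
  "Ck_on 0 S f \<longleftrightarrow> continuous_on S f"
| "Ck_on (Suc k) S f \<longleftrightarrow> f differentiable_on S \<and>
     (\<forall>v. Ck_on k S (\<lambda>x. frechet_derivative f (at x) v))"

text \<open>On a set that need not be open (such as a relatively open subset of a half-space),
  smoothness means that there are local smooth extensions to open sets.
  The predicate \<open>Ck_on\<close> is only used on open sets.\<close>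

definition smooth_on :: "'a::euclidean_space set \<Rightarrow> ('a \<Rightarrow> 'b::real_normed_vector) \<Rightarrow> bool" where
  "smooth_on S f \<longleftrightarrow> (\<forall>x\<in>S. \<exists>W g. open W \<and> x \<in> W \<and> (\<forall>k. Ck_on k W g) \<and> (\<forall>y\<in>S \<inter> W. g y = f y))"


section \<open>Smooth manifolds with boundary\<close>

text \<open>The manifold is the whole type \<open>'m\<close>, with the Hausdorff and second countability axioms
  supplied by type classes; \<open>'e\<close> is the model space. A chart is a pair \<open>(U, \<phi>)\<close>, where only
  the values of \<open>\<phi>\<close> on \<open>U\<close> are relevant.\<close>

type_synonym ('m, 'e) chart = "'m set \<times> ('m \<Rightarrow> 'e)"

definition halfspace :: "'e::euclidean_space \<Rightarrow> 'e set" where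
  "halfspace b = {x. 0 \<le> x \<bullet> b}"

definition is_chart :: "('m::topological_space, 'e::euclidean_space) chart \<Rightarrow> bool" where
  "is_chart = (\<lambda>(U, \<phi>). open U \<and> (\<exists>\<psi>. homeomorphism U (\<phi> ` U) \<phi> \<psi>) \<and>
     (open (\<phi> ` U) \<or> (\<exists>b\<in>Basis. openin (top_of_set (halfspace b)) (\<phi> ` U))))"

definition transition :: "('m, 'e) chart \<Rightarrow> ('m, 'e) chart \<Rightarrow> 'e \<Rightarrow> 'e" where
  "transition = (\<lambda>(U, \<phi>) (V, \<psi>). \<psi> \<circ> inv_into U \<phi>)"

definition compatible ::
  "('m, 'e::euclidean_space) chart \<Rightarrow> ('m, 'e) chart \<Rightarrow> bool" where
  "compatible c d \<longleftrightarrow> smooth_on (snd c ` (fst c \<inter> fst d)) (transition c d) \<and>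
     smooth_on (snd d ` (fst c \<inter> fst d)) (transition d c)"

definition smooth_structure :: "('m::topological_space, 'e::euclidean_space) chart set \<Rightarrow> bool" where
  "smooth_structure A \<longleftrightarrow> (\<forall>c\<in>A. is_chart c) \<and> (\<Union>c\<in>A. fst c) = UNIV \<and>
     (\<forall>c\<in>A. \<forall>d\<in>A. compatible c d) \<and>
     (\<forall>c. is_chart c \<and> (\<forall>d\<in>A. compatible c d) \<longrightarrow> c \<in> A)"

definition manifold_boundary :: "('m::topological_space, 'e::euclidean_space) chart set \<Rightarrow> 'm set" where
  "manifold_boundary A = {z. \<exists>(U, \<phi>)\<in>A. z \<in> U \<and>
     (\<exists>b\<in>Basis. openin (top_of_set (halfspace b)) (\<phi> ` U) \<and> \<phi> z \<bullet> b = 0)}"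


section \<open>Functions and Riemannian metrics in coordinates\<close>

definition smooth_function :: "('m, 'e::euclidean_space) chart set \<Rightarrow> ('m \<Rightarrow> real) \<Rightarrow> bool" where
  "smooth_function A f \<longleftrightarrow> (\<forall>(U, \<phi>)\<in>A. smooth_on (\<phi> ` U) (f \<circ> inv_into U \<phi>))"

text \<open>Tangent vectors are given by their components with respect to a chart;
  \<open>diff_coord c f z v\<close> is \<open>df(z)\<close> applied to the tangent vector with components \<open>v\<close>.\<close>

definition diff_coord :: "('m, 'e::euclidean_space) chart \<Rightarrow> ('m \<Rightarrow> real) \<Rightarrow> 'm \<Rightarrow> 'e \<Rightarrow> real" where
  "diff_coord = (\<lambda>(U, \<phi>) f z.
     frechet_derivative (f \<circ> inv_into U \<phi>) (at (\<phi> z) within \<phi> ` U))"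

definition hessian_coord ::
  "('m, 'e::euclidean_space) chart \<Rightarrow> ('m \<Rightarrow> real) \<Rightarrow> 'm \<Rightarrow> 'e \<Rightarrow> 'e \<Rightarrow> real" where
  "hessian_coord c f z v w = diff_coord c (\<lambda>y. diff_coord c f y v) z w"

definition critical :: "('m, 'e::euclidean_space) chart set \<Rightarrow> ('m \<Rightarrow> real) \<Rightarrow> 'm \<Rightarrow> bool" where
  "critical A f z \<longleftrightarrow> (\<forall>c\<in>A. z \<in> fst c \<longrightarrow> (\<forall>v. diff_coord c f z v = 0))"

definition morse_function ::
  "('m::topological_space, 'e::euclidean_space) chart set \<Rightarrow> ('m \<Rightarrow> real) \<Rightarrow> bool" where
  "morse_function A f \<longleftrightarrow> smooth_function A f \<and>
     (\<forall>z. critical A f z \<longrightarrow> z \<notin> manifold_boundary A \<and>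
        (\<forall>c\<in>A. z \<in> fst c \<longrightarrow> (\<forall>v. (\<forall>w. hessian_coord c f z v w = 0) \<longrightarrow> v = 0)))"

text \<open>A symmetric 2-tensor field assigns to each chart \<open>c\<close> and point \<open>z\<close> of its domain
  the bilinear form on components with respect to \<open>c\<close>, subject to the transformation law.\<close>

type_synonym ('m, 'e) form_field = "('m, 'e) chart \<Rightarrow> 'm \<Rightarrow> 'e \<Rightarrow> 'e \<Rightarrow> real"

definition riemannian_metric ::
  "('m, 'e::euclidean_space) chart set \<Rightarrow> ('m, 'e) form_field \<Rightarrow> bool" where
  "riemannian_metric A h \<longleftrightarrow>
     (\<forall>c\<in>A. \<forall>z\<in>fst c. bilinear (h c z) \<and> (\<forall>v w. h c z v w = h c z w v) \<and>
        (\<forall>v. v \<noteq> 0 \<longrightarrow> 0 < h c z v v)) \<and>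
     (\<forall>c\<in>A. \<forall>v w. smooth_on (snd c ` fst c) (\<lambda>x. h c (inv_into (fst c) (snd c) x) v w)) \<and>
     (\<forall>c\<in>A. \<forall>d\<in>A. \<forall>z\<in>fst c \<inter> fst d.
        let T = frechet_derivative (transition c d) (at (snd c z) within snd c ` (fst c \<inter> fst d))
        in \<forall>v w. h c z v w = h d z (T v) (T w))"


section \<open>Morse spacetimes\<close>

record ('m, 'e) morse_data =
  atlas :: "('m, 'e) chart set"
  metric :: "('m, 'e) form_field"
  morse :: "'m \<Rightarrow> real"
  zeta :: real

definition morse_conditions ::
  "('m::{t2_space,second_countable_topology}, 'e::euclidean_space) morse_data \<Rightarrow> bool" where
  "morse_conditions X \<longleftrightarrow> smooth_structure (atlas X) \<and> connected (UNIV :: 'm set) \<and>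
     riemannian_metric (atlas X) (metric X) \<and> morse_function (atlas X) (morse X) \<and> 1 < zeta X"

definition compact_morse_spacetime ::
  "('m::{t2_space,second_countable_topology}, 'e::euclidean_space) morse_data \<Rightarrow> bool" where
  "compact_morse_spacetime X \<longleftrightarrow> morse_conditions X \<and> compact (UNIV :: 'm set)"

definition coord_map ::
  "('m, 'e) chart \<Rightarrow> ('n, 'd) chart \<Rightarrow> ('m \<Rightarrow> 'n) \<Rightarrow> 'e \<Rightarrow> 'd" where
  "coord_map = (\<lambda>(U, \<phi>) (V, \<psi>) i. \<psi> \<circ> i \<circ> inv_into U \<phi>)"

definition coord_map_deriv ::
  "('m, 'e::euclidean_space) chart \<Rightarrow> ('n, 'd::euclidean_space) chart \<Rightarrow> ('m \<Rightarrow> 'n) \<Rightarrow> 'm \<Rightarrow> 'e \<Rightarrow> 'd" where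
  "coord_map_deriv c d i z =
     frechet_derivative (coord_map c d i) (at (snd c z) within snd c ` (fst c \<inter> i -` fst d))"

definition smooth_embedding ::
  "('m::topological_space, 'e::euclidean_space) chart set \<Rightarrow>
   ('n::topological_space, 'd::euclidean_space) chart set \<Rightarrow> ('m \<Rightarrow> 'n) \<Rightarrow> bool" where
  "smooth_embedding A B i \<longleftrightarrow> (\<exists>j. homeomorphism UNIV (range i) i j) \<and>
     (\<forall>c\<in>A. \<forall>d\<in>B. smooth_on (snd c ` (fst c \<inter> i -` fst d)) (coord_map c d i) \<and>
        (\<forall>z\<in>fst c \<inter> i -` fst d. inj (coord_map_deriv c d i z)))"

text \<open>The case of a Morse spacetime whose underlying manifold is a Euclidean space \<open>'e\<close>
  (expressed by a global chart onto \<open>'e\<close>). Its metric and Morse function are pulled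
  back along a smooth embedding \<open>i\<close> into a compact manifold \<open>'n\<close> carrying a
  Riemannian metric \<open>k\<close> and a smooth function \<open>F\<close>.\<close>

definition euclidean_morse_spacetime ::
  "('m::{t2_space,second_countable_topology}, 'e::euclidean_space) morse_data \<Rightarrow>
   ('n::{t2_space,second_countable_topology}, 'd::euclidean_space) chart set \<Rightarrow>
   ('n, 'd) form_field \<Rightarrow> ('n \<Rightarrow> real) \<Rightarrow> ('m \<Rightarrow> 'n) \<Rightarrow> bool" where
  "euclidean_morse_spacetime X B k F i \<longleftrightarrow> morse_conditions X \<and>
     (\<exists>\<phi>. (UNIV, \<phi>) \<in> atlas X \<and> range \<phi> = UNIV) \<and>
     compact (UNIV :: 'n set) \<and> smooth_structure B \<and> riemannian_metric B k \<and> smooth_function B F \<and>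
     smooth_embedding (atlas X) B i \<and> morse X = F \<circ> i \<and>
     (\<forall>c\<in>atlas X. \<forall>d\<in>B. \<forall>z\<in>fst c \<inter> i -` fst d. \<forall>v w.
        metric X c z v w = k d (i z) (coord_map_deriv c d i z v) (coord_map_deriv c d i z w))"


section \<open>The Morse-Lorentzian metric and its causal structure\<close>

definition gradient :: "('m, 'e::euclidean_space) morse_data \<Rightarrow> ('m, 'e) chart \<Rightarrow> 'm \<Rightarrow> 'e" where
  "gradient X c z = (THE u. \<forall>v. metric X c z u v = diff_coord c (morse X) z v)"

definition lorentz_metric :: "('m, 'e::euclidean_space) morse_data \<Rightarrow> ('m, 'e) form_field" where
  "lorentz_metric X c z v w =
     metric X c z (gradient X c z) (gradient X c z) * metric X c z v w -
     zeta X * diff_coord c (morse X) z v * diff_coord c (morse X) z w"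

text \<open>A sign \<open>s = 1\<close> stands for positive (future), \<open>s = -1\<close> for negative (past) orientation.\<close>

definition timelike ::
  "('m, 'e::euclidean_space) morse_data \<Rightarrow> real \<Rightarrow> ('m, 'e) chart \<Rightarrow> 'm \<Rightarrow> 'e \<Rightarrow> bool" where
  "timelike X s c z v \<longleftrightarrow> lorentz_metric X c z v v < 0 \<and> 0 < s * diff_coord c (morse X) z v"

definition velocity ::
  "('m, 'e::euclidean_space) chart \<Rightarrow> (real \<Rightarrow> 'm) \<Rightarrow> real set \<Rightarrow> real \<Rightarrow> 'e" where
  "velocity c \<gamma> I t = vector_derivative (snd c \<circ> \<gamma>) (at t within I)"

definition timelike_at ::
  "('m, 'e::euclidean_space) morse_data \<Rightarrow> real \<Rightarrow> (real \<Rightarrow> 'm) \<Rightarrow> real set \<Rightarrow> real \<Rightarrow> bool" where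
  "timelike_at X s \<gamma> I t \<longleftrightarrow> (\<forall>c\<in>atlas X. \<gamma> t \<in> fst c \<longrightarrow>
     (snd c \<circ> \<gamma>) differentiable (at t within I) \<and>
     continuous (at t within I) (velocity c \<gamma> I) \<and>
     timelike X s c (\<gamma> t) (velocity c \<gamma> I t))"

text \<open>A single piece of a broken curve: a continuously differentiable timelike curve on a
  compact interval, except that its endpoints may be critical points, where only
  continuity is required.\<close>

definition timelike_piece ::
  "('m::topological_space, 'e::euclidean_space) morse_data \<Rightarrow> real \<Rightarrow> (real \<Rightarrow> 'm) \<Rightarrow> real \<Rightarrow> real \<Rightarrow> bool" where
  "timelike_piece X s \<gamma> a b \<longleftrightarrow> a < b \<and> continuous_on {a..b} \<gamma> \<and>
     (\<forall>t\<in>{a<..<b}. \<not> critical (atlas X) (morse X) (\<gamma> t)) \<and>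
     (\<forall>t\<in>{a..b}. \<not> critical (atlas X) (morse X) (\<gamma> t) \<longrightarrow> timelike_at X s \<gamma> {a..b} t)"

definition joined_by_piece ::
  "('m::topological_space, 'e::euclidean_space) morse_data \<Rightarrow> real \<Rightarrow> 'm \<Rightarrow> 'm \<Rightarrow> bool" where
  "joined_by_piece X s z w \<longleftrightarrow> (\<exists>\<gamma> a b. timelike_piece X s \<gamma> a b \<and> \<gamma> a = z \<and> \<gamma> b = w)"

definition chron_future :: "('m::topological_space, 'e::euclidean_space) morse_data \<Rightarrow> 'm \<Rightarrow> 'm set" where
  "chron_future X z = {w. (joined_by_piece X 1)\<^sup>+\<^sup>+ z w}"

definition chron_past :: "('m::topological_space, 'e::euclidean_space) morse_data \<Rightarrow> 'm \<Rightarrow> 'm set" where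
  "chron_past X z = {w. (joined_by_piece X (-1))\<^sup>+\<^sup>+ z w}"

definition distinguishing :: "('m::topological_space, 'e::euclidean_space) morse_data \<Rightarrow> bool" where
  "distinguishing X \<longleftrightarrow> (\<forall>p q. chron_future X p = chron_future X q \<or> chron_past X p = chron_past X q
     \<longrightarrow> p = q)"

definition reflecting_at :: "('m::topological_space, 'e::euclidean_space) morse_data \<Rightarrow> 'm \<Rightarrow> 'm \<Rightarrow> bool" where
  "reflecting_at X p q \<longleftrightarrow>
     (chron_future X p \<subseteq> chron_future X q \<longleftrightarrow> chron_past X q \<subseteq> chron_past X p)"

definition reflecting :: "('m::topological_space, 'e::euclidean_space) morse_data \<Rightarrow> bool" where
  "reflecting X \<longleftrightarrow> (\<forall>p q. reflecting_at X p q)"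

definition causally_continuous :: "('m::topological_space, 'e::euclidean_space) morse_data \<Rightarrow> bool" where
  "causally_continuous X \<longleftrightarrow> distinguishing X \<and> reflecting X"

definition points_of_causal_discontinuity ::
  "('m::topological_space, 'e::euclidean_space) morse_data \<Rightarrow> 'm \<Rightarrow> 'm \<Rightarrow> bool" where
  "points_of_causal_discontinuity X p q \<longleftrightarrow> \<not> reflecting_at X p q"


section \<open>Local charts with prescribed data\<close>

definition admits_local_chart ::
  "('m::topological_space, 'e::euclidean_space) morse_data \<Rightarrow> ('m, 'e) chart \<Rightarrow>
   ('e \<Rightarrow> 'e \<Rightarrow> 'e \<Rightarrow> real) \<Rightarrow> ('e \<Rightarrow> real) \<Rightarrow> real \<Rightarrow> bool" where
  "admits_local_chart X c h f \<zeta> \<longleftrightarrow> c \<in> atlas X \<and> open (snd c ` fst c) \<and> zeta X = \<zeta> \<and>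
     (\<exists>z\<in>fst c. critical (atlas X) (morse X) z \<and> snd c z = 0) \<and>
     (\<forall>z\<in>fst c. metric X c z = h (snd c z) \<and> morse X z = f (snd c z))"

text \<open>The coordinates \<open>(x\<^sub>1, x\<^sub>2, y\<^sub>1, y\<^sub>2)\<close> on \<open>real^4\<close> are the components 1, 2, 3, 4.\<close>

definition euclidean_h :: "real^4 \<Rightarrow> real^4 \<Rightarrow> real^4 \<Rightarrow> real" where
  "euclidean_h x v w = v $ 1 * w $ 1 + v $ 2 * w $ 2 + v $ 3 * w $ 3 + v $ 4 * w $ 4"

definition anisotropic_f :: "real^4 \<Rightarrow> real" where
  "anisotropic_f x = (1/2) * (- (x $ 1)\<^sup>2 - 8 * (x $ 2)\<^sup>2 + (x $ 3)\<^sup>2 + (x $ 4)\<^sup>2)"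

lemma vector_4:
  "(vector [a, b, c, d] :: 'a::zero^4) $ 1 = a"
  "(vector [a, b, c, d] :: 'a::zero^4) $ 2 = b"
  "(vector [a, b, c, d] :: 'a::zero^4) $ 3 = c"
  "(vector [a, b, c, d] :: 'a::zero^4) $ 4 = d"
  by (simp_all add: vector_def)

text \<open>A chart of a compact manifold in which the metric is Euclidean covers only part of \<open>real^4\<close>.
  The two points below are meant in a chart whose image contains the open ball of radius 3 about 0:
  both have norm less than 3, and since \<open>|z|\<^sup>2 + 2 * sqrt 2 * f\<close> and \<open>2 * sqrt 2 * f - |z|\<^sup>2\<close>
  increase along future timelike curves, no such curve between them, or between nearby points, leaves
  that ball. In a chart whose image merely contains the two points, their causal relation would
  depend on the unspecified data outside the chart.\<close>

definition q_coord :: "real^4" where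
  "q_coord = vector [sqrt 2 + 1, 0, 1, 0]"

definition p_coord :: "real^4" where
  "p_coord = vector [- (sqrt 2 - 1), 0, 1, 0]"

end

theory Submission
  imports Defs
begin

text \<open>
  In the chart, with \<open>s = 1\<close> for the future and \<open>s = -1\<close> for the past, a vector is timelike if its
  Euclidean angle with \<open>s \<nabla>f = s (-x\<^sub>1, -8x\<^sub>2, y\<^sub>1, y\<^sub>2)\<close> is less than 45 degrees. On the plane
  \<open>x\<^sub>2 = y\<^sub>2 = 0\<close> the functions \<open>f + x\<^sub>1y\<^sub>1\<close> and \<open>f - x\<^sub>1y\<^sub>1\<close> are null coordinates. The points \<open>q\<close> and
  \<open>p\<close> both lie on the pair of null lines \<open>f + x\<^sub>1y\<^sub>1 = 0\<close> through the critical point: \<open>q\<close> on a ray along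
  which future-directed null curves run into the critical point, \<open>p\<close> on the ray along which they leave
  it. Two facts show that reflectivity fails for \<open>p\<close> and \<open>q\<close>.

  The future of \<open>p\<close> lies in the future of \<open>q\<close>. Between the two rays there is a sector of the plane
  in which \<open>f + x\<^sub>1y\<^sub>1 > 0\<close>; a hyperbola-like curve through it (lemma \<open>arc_timelike\<close>), slightly steeper
  than the null curves, is timelike and joins \<open>q\<close> to points arbitrarily close to \<open>p\<close>. As the past of a
  point in the future of \<open>p\<close> contains a neighbourhood of \<open>p\<close> (lemma \<open>joined_from_nearby\<close>), the
  inclusion follows.

  The past of \<open>q\<close> does not lie in the past of \<open>p\<close>. The function \<open>\<tau> = f + x\<^sub>1y\<^sub>1\<close> increases along
  future timelike curves of the whole chart, because \<open>\<nabla>(x\<^sub>1y\<^sub>1)\<close> is orthogonal to \<open>\<nabla>f\<close> and not longer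
  than it. So the past of \<open>p\<close> lies in \<open>\<tau> < 0\<close>. In the plane the set \<open>\<tau> < 0\<close> falls apart into two
  sectors, one with \<open>x\<^sub>1 > 0\<close> and \<open>q\<close> on its boundary, one with \<open>x\<^sub>1 < 0\<close> and \<open>p\<close> on its boundary; in \<open>\<real>\<^sup>4\<close> it is connected,
  and a curve could pass from one side to the other by moving around the critical point through
  \<open>x\<^sub>2 \<noteq> 0\<close>. The eigenvalue \<open>-8\<close> prevents this. In the plane \<open>y\<^sub>1 = y\<^sub>2 = 0\<close> the null directions are
  those of a linear flow with characteristic polynomial \<open>\<lambda>\<^sup>2 + 9\<lambda> + 16\<close>, whose roots are real since
  \<open>9\<^sup>2 > 4 \<cdot> 16\<close>. So null curves do not spiral around the critical point, as they would for equal
  eigenvalues, but are stopped by invariant rays. The quadratic cone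
  \<open>(x\<^sub>1 - y\<^sub>1/6)\<^sup>2 = 8x\<^sub>2\<^sup>2 - y\<^sub>2\<^sup>2/4\<close> with \<open>x\<^sub>1 > y\<^sub>1/6\<close> extends this obstruction to all of \<open>\<tau> \<le> 0\<close>: by lemma
  \<open>barrier_quad_decreasing\<close>, past timelike curves cross it only away from the side of \<open>q\<close>.

  A curve could still leave the chart and come back. This is excluded because \<open>2\<surd>2 f + |z|\<^sup>2\<close> and
  \<open>2\<surd>2 f - |z|\<^sup>2\<close> both increase along future timelike curves of the chart while \<open>f\<close> does so on the whole manifold:
  a past curve from \<open>p\<close> that has left a ball of radius about 3 has lost so much of \<open>f\<close> that after a
  return its value of \<open>2\<surd>2 f - |z|\<^sup>2\<close> is below the one at \<open>q\<close>. Lemma \<open>chron_past_subset\<close> combines the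
  barrier and this bound.

  Everything in the chart is homogeneous, so the argument applies to the points \<open>rp\<close> and \<open>rq\<close> for
  every \<open>r > 0\<close> such that the ball of radius \<open>3r\<close> lies in the chart. Small \<open>r\<close> gives causal
  discontinuity for any size of the chart, and \<open>r = 1\<close> gives the stated points.
\<close>

section \<open>The causal cones in coordinates\<close>

definition grad_f :: "real^4 \<Rightarrow> real^4" where
  "grad_f z = vector [- z $ 1, - 8 * z $ 2, z $ 3, z $ 4]"

definition timelike_cone :: "real \<Rightarrow> real^4 \<Rightarrow> real^4 \<Rightarrow> bool" where
  "timelike_cone s z v \<longleftrightarrow> (grad_f z \<bullet> grad_f z) * (v \<bullet> v) < 2 * (grad_f z \<bullet> v)\<^sup>2 \<and> 0 < s * (grad_f z \<bullet> v)"

lemma grad_f_nth [simp]: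
  "grad_f z $ 1 = - z $ 1" "grad_f z $ 2 = - 8 * z $ 2" "grad_f z $ 3 = z $ 3" "grad_f z $ 4 = z $ 4"
  by (simp_all add: grad_f_def vector_4)

lemma inner_4: "(v::real^4) \<bullet> w = v $ 1 * w $ 1 + v $ 2 * w $ 2 + v $ 3 * w $ 3 + v $ 4 * w $ 4"
  by (simp add: inner_vec_def sum_4)

lemma vec_eq_iff_4: "(v::real^4) = w \<longleftrightarrow> v $ 1 = w $ 1 \<and> v $ 2 = w $ 2 \<and> v $ 3 = w $ 3 \<and> v $ 4 = w $ 4"
  by (simp add: vec_eq_iff forall_4)

lemma euclidean_h_eq_inner: "euclidean_h x v w = v \<bullet> w"
  by (simp add: euclidean_h_def inner_4)

lemma grad_f_scaleR: "grad_f (r *\<^sub>R z) = r *\<^sub>R grad_f z"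
  by (simp add: vec_eq_iff_4)

lemma has_derivative_vec_nth: "((\<lambda>x. x $ i) has_derivative (\<lambda>x. x $ i)) F"
  by (rule bounded_linear_imp_has_derivative[OF bounded_linear_vec_nth])

lemma has_derivative_anisotropic_f: "(anisotropic_f has_derivative (\<lambda>v. grad_f z \<bullet> v)) (at z within S)"
  unfolding anisotropic_f_def
  by (auto intro!: derivative_eq_intros has_derivative_vec_nth ext simp: inner_4 algebra_simps)

lemma timelike_cone_nonzero: "timelike_cone s z v \<Longrightarrow> z \<noteq> 0"
  by (auto simp: timelike_cone_def grad_f_def inner_4 vector_4)

lemma timelike_cone_scaleR:
  assumes "r > 0" "timelike_cone s z v"
  shows "timelike_cone s (r *\<^sub>R z) (r *\<^sub>R v)"
proof -
  have "r^4 * ((grad_f z \<bullet> grad_f z) * (v \<bullet> v)) < r^4 * (2 * (grad_f z \<bullet> v)\<^sup>2)"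
    using assms by (intro mult_strict_left_mono) (auto simp: timelike_cone_def)
  moreover have "0 < r^2 * (s * (grad_f z \<bullet> v))"
    using assms by (auto simp: timelike_cone_def)
  ultimately show ?thesis
    unfolding timelike_cone_def grad_f_scaleR
    by (simp add: power2_eq_square power4_eq_xxxx algebra_simps)
qed

text \<open>The angle between \<open>w\<close> and \<open>g\<close> is at most 45 degrees and that between \<open>v\<close> and \<open>-g\<close> is less than
  45 degrees, so \<open>w\<close> and \<open>v\<close> enclose more than a right angle. With \<open>g = \<nabla>f\<close> and \<open>w\<close> the gradient of
  another function, this shows that the latter decreases along past timelike curves.\<close>

lemma dual_cone_negative:
  fixes g w v :: "'a::real_inner"
  assumes "(g \<bullet> g) * (w \<bullet> w) \<le> 2 * (w \<bullet> g)\<^sup>2" "0 < w \<bullet> g"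
    and "(g \<bullet> g) * (v \<bullet> v) < 2 * (g \<bullet> v)\<^sup>2" "g \<bullet> v < 0"
  shows "w \<bullet> v < 0"
proof -
  define N where "N = g \<bullet> g"
  \<comment> \<open>The components orthogonal to \<open>g\<close>, scaled by \<open>N\<close> to avoid division.\<close>
  define w' where "w' = N *\<^sub>R w - (w \<bullet> g) *\<^sub>R g"
  define v' where "v' = N *\<^sub>R v - (g \<bullet> v) *\<^sub>R g"
  have "g \<noteq> 0" using assms by auto
  then have N: "N > 0" by (simp add: N_def)
  have w': "w' \<bullet> w' = N * (N * (w \<bullet> w) - (w \<bullet> g)\<^sup>2)"
    by (simp add: w'_def N_def algebra_simps power2_eq_square inner_commute)
  have v': "v' \<bullet> v' = N * (N * (v \<bullet> v) - (g \<bullet> v)\<^sup>2)"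
    by (simp add: v'_def N_def algebra_simps power2_eq_square inner_commute)
  have wv: "w' \<bullet> v' = N * (N * (w \<bullet> v) - (w \<bullet> g) * (g \<bullet> v))"
    by (simp add: w'_def v'_def N_def algebra_simps power2_eq_square inner_commute)
  have 1: "w' \<bullet> w' \<le> N * (w \<bullet> g)\<^sup>2"
    unfolding w' using N assms by (intro mult_left_mono) (auto simp: N_def)
  have 2: "v' \<bullet> v' < N * (g \<bullet> v)\<^sup>2"
    unfolding v' using N assms by (intro mult_strict_left_mono) (auto simp: N_def)
  have "(w' \<bullet> v')\<^sup>2 \<le> (w' \<bullet> w') * (v' \<bullet> v')"
    by (rule Cauchy_Schwarz_ineq)
  also have "\<dots> \<le> (N * (w \<bullet> g)\<^sup>2) * (v' \<bullet> v')"
    using 1 by (intro mult_right_mono) auto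
  also have "\<dots> < (N * (w \<bullet> g)\<^sup>2) * (N * (g \<bullet> v)\<^sup>2)"
    using 2 N assms(2) by (intro mult_strict_left_mono) auto
  also have "\<dots> = (N * (w \<bullet> g) * (- (g \<bullet> v)))\<^sup>2"
    by (simp add: power2_eq_square algebra_simps)
  finally have "w' \<bullet> v' < N * (w \<bullet> g) * (- (g \<bullet> v))"
    by (rule power2_less_imp_less) (use N assms in \<open>auto intro!: mult_nonneg_nonneg simp: mult_nonneg_nonpos\<close>)
  then have "N * (N * (w \<bullet> v)) < N * 0"
    unfolding wv by (simp add: algebra_simps)
  then show ?thesis using N by (simp add: mult_less_0_iff)
qed

section \<open>Functions that decrease along past timelike curves\<close>

definition tau :: "real^4 \<Rightarrow> real" where
  "tau z = anisotropic_f z + z $ 1 * z $ 3"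

definition tau_grad :: "real^4 \<Rightarrow> real^4" where
  "tau_grad z = vector [z $ 3 - z $ 1, - 8 * z $ 2, z $ 1 + z $ 3, z $ 4]"

lemma tau_has_derivative: "(tau has_derivative (\<lambda>v. tau_grad z \<bullet> v)) (at z within S)"
  unfolding tau_def anisotropic_f_def
  by (auto intro!: derivative_eq_intros has_derivative_vec_nth ext simp: tau_grad_def vector_4 inner_4 algebra_simps)

text \<open>The gradient of \<open>x\<^sub>1y\<^sub>1\<close> is orthogonal to that of \<open>f\<close> and at most as long, hence the gradient of their
  sum is within 45 degrees of \<open>\<nabla>f\<close>.\<close>

lemma tau_decreasing:
  assumes "timelike_cone (-1) z v"
  shows "tau_grad z \<bullet> v < 0"
proof (rule dual_cone_negative[of "grad_f z"])
  have "z \<noteq> 0" using assms by (rule timelike_cone_nonzero)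
  then have z: "0 < grad_f z \<bullet> grad_f z"
    by (auto simp: vec_eq_iff_4)
  have eq: "tau_grad z \<bullet> grad_f z = grad_f z \<bullet> grad_f z"
    by (simp add: tau_grad_def vector_4 inner_4 algebra_simps)
  then show "0 < tau_grad z \<bullet> grad_f z" using z by simp
  have "tau_grad z \<bullet> tau_grad z = (grad_f z \<bullet> grad_f z) + (z $ 1)\<^sup>2 + (z $ 3)\<^sup>2"
    by (simp add: tau_grad_def vector_4 inner_4 algebra_simps power2_eq_square)
  also have "\<dots> \<le> 2 * (grad_f z \<bullet> grad_f z)"
    by (simp add: inner_4 power2_eq_square)
  finally show "(grad_f z \<bullet> grad_f z) * (tau_grad z \<bullet> tau_grad z) \<le> 2 * (tau_grad z \<bullet> grad_f z)\<^sup>2"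
    unfolding eq using z by (simp add: power2_eq_square mult_left_mono)
qed (use assms in \<open>auto simp: timelike_cone_def\<close>)

text \<open>All eigenvalues of the Hessian of \<open>f\<close> have modulus at least 1. Therefore \<open>|z \<bullet> v|\<close>, which is half of the rate of change of
  \<open>|z|\<^sup>2\<close>, is dominated along timelike directions by \<open>\<surd>2\<close> times the rate of change of \<open>f\<close>.\<close>

lemma norm_le_norm_grad_f: "norm z \<le> norm (grad_f z)"
proof -
  have "z \<bullet> z \<le> grad_f z \<bullet> grad_f z"
    by (simp add: inner_4)
  then show ?thesis by (simp add: norm_eq_sqrt_inner)
qed

lemma radial_bound:
  assumes "timelike_cone (-1) z v"
  shows "\<bar>z \<bullet> v\<bar> < - sqrt 2 * (grad_f z \<bullet> v)"
proof -
  have "\<bar>z \<bullet> v\<bar> \<le> norm z * norm v" by (rule Cauchy_Schwarz_ineq2)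
  also have "\<dots> \<le> norm (grad_f z) * norm v"
    by (intro mult_right_mono norm_le_norm_grad_f) auto
  also have "\<dots> < - sqrt 2 * (grad_f z \<bullet> v)"
  proof (rule power2_less_imp_less)
    show "(norm (grad_f z) * norm v)\<^sup>2 < (- sqrt 2 * (grad_f z \<bullet> v))\<^sup>2"
      using assms by (simp add: timelike_cone_def power_mult_distrib power2_norm_eq_inner)
  qed (use assms in \<open>auto simp: timelike_cone_def mult_nonneg_nonpos\<close>)
  finally show ?thesis .
qed

definition radial_plus :: "real^4 \<Rightarrow> real" where "radial_plus z = 2 * sqrt 2 * anisotropic_f z + z \<bullet> z"
definition radial_minus :: "real^4 \<Rightarrow> real" where "radial_minus z = 2 * sqrt 2 * anisotropic_f z - z \<bullet> z"

lemma radial_plus_has_derivative: "(radial_plus has_derivative (\<lambda>v. 2 * sqrt 2 * (grad_f z \<bullet> v) + 2 * (z \<bullet> v))) (at z within S)"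
  unfolding radial_plus_def
  by (auto intro!: derivative_eq_intros has_derivative_anisotropic_f simp: inner_commute)

lemma radial_minus_has_derivative: "(radial_minus has_derivative (\<lambda>v. 2 * sqrt 2 * (grad_f z \<bullet> v) - 2 * (z \<bullet> v))) (at z within S)"
  unfolding radial_minus_def
  by (auto intro!: derivative_eq_intros has_derivative_anisotropic_f simp: inner_commute)

lemma radial_plus_decreasing: "timelike_cone (-1) z v \<Longrightarrow> 2 * sqrt 2 * (grad_f z \<bullet> v) + 2 * (z \<bullet> v) < 0"
  using radial_bound[of z v] by linarith

lemma radial_minus_decreasing: "timelike_cone (-1) z v \<Longrightarrow> 2 * sqrt 2 * (grad_f z \<bullet> v) - 2 * (z \<bullet> v) < 0"
  using radial_bound[of z v] by linarith

section \<open>The barrier around the critical point\<close>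

text \<open>In the plane \<open>y\<^sub>1 = y\<^sub>2 = 0\<close> the zero set of \<open>barrier_quad\<close> consists of the lines
  \<open>x\<^sub>2 = \<plusminus> x\<^sub>1/\<surd>8\<close>. Their slope lies between the slopes \<open>(7 \<plusminus> \<surd>17)/16\<close> of the two invariant rays of the
  null directions, which makes these lines one-way. The tilt \<open>y\<^sub>1/6\<close> and the term \<open>y\<^sub>2\<^sup>2/4\<close> are
  chosen such that this persists for all \<open>y\<^sub>1, y\<^sub>2\<close> with \<open>\<tau> \<le> 0\<close>.\<close>

definition barrier_lin :: "real^4 \<Rightarrow> real" where "barrier_lin z = z $ 1 - z $ 3 / 6"
definition barrier_quad :: "real^4 \<Rightarrow> real" where "barrier_quad z = (barrier_lin z)\<^sup>2 - 8 * (z $ 2)\<^sup>2 + (z $ 4)\<^sup>2 / 4"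
definition barrier_grad :: "real^4 \<Rightarrow> real^4" where
  "barrier_grad z = vector [2 * barrier_lin z, - 16 * z $ 2, - barrier_lin z / 3, z $ 4 / 2]"

lemma barrier_quad_has_derivative: "(barrier_quad has_derivative (\<lambda>v. barrier_grad z \<bullet> v)) (at z within S)"
  unfolding barrier_quad_def barrier_lin_def
  by (auto intro!: derivative_eq_intros has_derivative_vec_nth ext simp: barrier_grad_def barrier_lin_def vector_4 inner_4 field_simps)

lemma tau_expand:
  "2 * tau z = (z $ 3)\<^sup>2 + 2 * z $ 1 * z $ 3 - (z $ 1)\<^sup>2 - 8 * (z $ 2)\<^sup>2 + (z $ 4)\<^sup>2"
  by (simp add: tau_def anisotropic_f_def)

text \<open>The angle condition of \<open>dual_cone_negative\<close> on the barrier, after elimination of \<open>x\<^sub>1\<close> and \<open>x\<^sub>2\<close>. Here \<open>L\<close>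
  stands for \<open>barrier_lin\<close>, \<open>y\<close> and \<open>w\<close> for \<open>y\<^sub>1\<close> and \<open>y\<^sub>2\<close>, and \<open>c\<close> is \<open>-2\<tau>\<close>. The polynomial inequality
  fails without the constraint \<open>c \<ge> 0\<close>.\<close>

lemma barrier_inequality:
  fixes L y w :: real
  defines "c \<equiv> 2 * L\<^sup>2 - 5 / 3 * (L * y) - 47 / 36 * y\<^sup>2 - 3 / 4 * w\<^sup>2"
  assumes "0 \<le> c"
  shows "(9 * L\<^sup>2 + L * y / 3 + 37 / 36 * y\<^sup>2 + 3 * w\<^sup>2) * (325 / 36 * L\<^sup>2 + 33 / 16 * w\<^sup>2)
         \<le> 2 * (7 * L\<^sup>2 - L * y / 3 + 9 / 4 * w\<^sup>2)\<^sup>2"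
proof -
  have 1: "0 \<le> (7 * L\<^sup>2 + 2 * w\<^sup>2) * c" using assms by simp
  have 2: "0 \<le> L\<^sup>2 * (11/4 * (L + (-73/594) * y)\<^sup>2 + 329/8019 * y\<^sup>2)"
    by simp
  have 3: "0 \<le> w\<^sup>2 * (893/48 * (L + (-17/1786) * y)\<^sup>2 + 62963/128592 * y\<^sup>2 + 87/16 * w\<^sup>2)"
    by simp
  \<comment> \<open>The multiplier of \<open>c\<close> is chosen such that the rest is a sum of squares.\<close>
  have "2 * (7 * L\<^sup>2 - L * y / 3 + 9 / 4 * w\<^sup>2)\<^sup>2
      - (9 * L\<^sup>2 + L * y / 3 + 37 / 36 * y\<^sup>2 + 3 * w\<^sup>2) * (325 / 36 * L\<^sup>2 + 33 / 16 * w\<^sup>2)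
    = (7 * L\<^sup>2 + 2 * w\<^sup>2) * c
    + L\<^sup>2 * (11/4 * (L + (-73/594) * y)\<^sup>2 + 329/8019 * y\<^sup>2)
    + w\<^sup>2 * (893/48 * (L + (-17/1786) * y)\<^sup>2 + 62963/128592 * y\<^sup>2 + 87/16 * w\<^sup>2)"
    unfolding c_def by (simp add: power2_eq_square field_simps)
  then show ?thesis using 1 2 3 by linarith
qed

text \<open>A past timelike curve in \<open>\<tau> \<le> 0\<close> can pass through the barrier only towards negative values of
  \<open>barrier_quad\<close>, that is, away from the side on which \<open>q\<close> lies.\<close>

lemma barrier_quad_decreasing:
  assumes "barrier_quad z = 0" "0 < barrier_lin z" "tau z \<le> 0" "timelike_cone (-1) z v"
  shows "barrier_grad z \<bullet> v < 0"
proof (rule dual_cone_negative[of "grad_f z"])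
  define L y w where "L = barrier_lin z" and "y = z $ 3" and "w = z $ 4"
  have z1: "z $ 1 = L + y / 6" by (simp add: L_def y_def barrier_lin_def)
  have z2: "z $ 2 * z $ 2 = L * L / 8 + w * w / 32"
    using assms(1) by (simp add: barrier_quad_def L_def w_def power2_eq_square)
  define c where "c = 2 * L\<^sup>2 - 5 / 3 * (L * y) - 47 / 36 * y\<^sup>2 - 3 / 4 * w\<^sup>2"
  have "2 * tau z = - c"
    unfolding tau_expand c_def power2_eq_square z1 z2
    by (simp add: y_def[symmetric] w_def[symmetric] field_simps)
  then have c: "0 \<le> c" using assms(3) by simp
  have dot: "barrier_grad z \<bullet> grad_f z = 2 * (7 * L\<^sup>2 - L * y / 3 + 9 / 4 * w\<^sup>2)"
  proof -
    have "barrier_grad z \<bullet> grad_f z = - 2 * L * z $ 1 + 128 * (z $ 2 * z $ 2) - L * y / 3 + w\<^sup>2 / 2"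
      by (simp add: inner_4 barrier_grad_def vector_4 L_def y_def w_def power2_eq_square)
    then show ?thesis
      unfolding z1 z2 by (simp add: power2_eq_square field_simps)
  qed
  have gg: "grad_f z \<bullet> grad_f z = 9 * L\<^sup>2 + L * y / 3 + 37 / 36 * y\<^sup>2 + 3 * w\<^sup>2"
  proof -
    have "grad_f z \<bullet> grad_f z = (z $ 1)\<^sup>2 + 64 * (z $ 2 * z $ 2) + y\<^sup>2 + w\<^sup>2"
      by (simp add: inner_4 y_def w_def power2_eq_square)
    then show ?thesis
      unfolding z1 z2 by (simp add: power2_eq_square field_simps)
  qed
  have qq: "barrier_grad z \<bullet> barrier_grad z = 4 * (325 / 36 * L\<^sup>2 + 33 / 16 * w\<^sup>2)"
  proof -
    have "barrier_grad z \<bullet> barrier_grad z = 4 * L\<^sup>2 + 256 * (z $ 2 * z $ 2) + L\<^sup>2 / 9 + w\<^sup>2 / 4"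
      by (simp add: inner_4 barrier_grad_def vector_4 L_def w_def power2_eq_square)
    then show ?thesis
      unfolding z2 by (simp add: power2_eq_square field_simps)
  qed
  have "(grad_f z \<bullet> grad_f z) * (325 / 36 * L\<^sup>2 + 33 / 16 * w\<^sup>2)
      \<le> 2 * (7 * L\<^sup>2 - L * y / 3 + 9 / 4 * w\<^sup>2)\<^sup>2"
    unfolding gg by (rule barrier_inequality) (use c in \<open>simp add: c_def\<close>)
  then show "(grad_f z \<bullet> grad_f z) * (barrier_grad z \<bullet> barrier_grad z) \<le> 2 * (barrier_grad z \<bullet> grad_f z)\<^sup>2"
    unfolding dot qq power_mult_distrib by (simp only: mult.left_commute[of _ 4]) simp
  have "0 < L\<^sup>2" using assms(2) by (simp add: L_def)
  moreover have "0 \<le> y\<^sup>2" "0 \<le> w\<^sup>2" by simp_all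
  ultimately show "0 < barrier_grad z \<bullet> grad_f z"
    unfolding dot using c unfolding c_def by argo
qed (use assms in \<open>auto simp: timelike_cone_def\<close>)

text \<open>In \<open>\<tau> < 0\<close> the side of \<open>q\<close>, given by nonnegative \<open>barrier_lin\<close> and \<open>barrier_quad\<close>, is bounded by the
  cone alone; the hyperplane \<open>barrier_lin = 0\<close> does not contribute to its boundary.\<close>

lemma barrier_lin_nonzero:
  assumes "tau z < 0" "0 \<le> barrier_quad z"
  shows "barrier_lin z \<noteq> 0"
proof
  assume l: "barrier_lin z = 0"
  then have z1: "z $ 1 = z $ 3 / 6" by (simp add: barrier_lin_def)
  have "32 * (z $ 2)\<^sup>2 \<le> (z $ 4)\<^sup>2" using assms(2) l by (simp add: barrier_quad_def)
  moreover have "0 > 47 / 36 * (z $ 3)\<^sup>2 - 8 * (z $ 2)\<^sup>2 + (z $ 4)\<^sup>2"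
    using assms(1) tau_expand[of z] unfolding z1 by (simp add: power2_eq_square field_simps)
  moreover have "0 \<le> (z $ 3)\<^sup>2" "0 \<le> (z $ 2)\<^sup>2" "0 \<le> (z $ 4)\<^sup>2" by simp_all
  ultimately show False by linarith
qed

lemma timelike_cone_open:
  assumes "timelike_cone s z v"
  obtains d where "d > 0" "\<And>z' v'. dist z' z < d \<Longrightarrow> dist v' v < d \<Longrightarrow> timelike_cone s z' v'"
proof -
  define S where "S = {p::(real^4) \<times> (real^4). timelike_cone s (fst p) (snd p)}"
  have "open S"
    unfolding S_def timelike_cone_def inner_4 grad_f_nth
    by (intro open_Collect_conj open_Collect_less continuous_intros)
  moreover have "(z, v) \<in> S" using assms by (simp add: S_def)
  ultimately obtain A B where AB: "open A" "open B" "z \<in> A" "v \<in> B" "A \<times> B \<subseteq> S"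
    by (metis open_prod_elim mem_Sigma_iff)
  obtain d1 where d1: "d1 > 0" "\<And>z'. dist z' z < d1 \<Longrightarrow> z' \<in> A"
    using AB open_dist by blast
  obtain d2 where d2: "d2 > 0" "\<And>v'. dist v' v < d2 \<Longrightarrow> v' \<in> B"
    using AB open_dist by blast
  show ?thesis
  proof (rule that[of "min d1 d2"])
    show "timelike_cone s z' v'" if "dist z' z < min d1 d2" "dist v' v < min d1 d2" for z' v'
      using AB(5) d1(2)[of z'] d2(2)[of v'] that by (auto simp: S_def)
  qed (use d1 d2 in auto)
qed

section \<open>Smooth maps, charts and curves\<close>

lemma Ck_on_Suc_derivative:
  assumes "Ck_on (Suc 0) W g" "open W" "x \<in> W"
  shows "(g has_derivative frechet_derivative g (at x)) (at x)"
proof -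
  have "g differentiable (at x)"
    using assms by (simp add: differentiable_on_eq_differentiable_at)
  then show ?thesis unfolding frechet_derivative_works .
qed

lemma smooth_on_differentiable_within:
  assumes "smooth_on S f" "x \<in> S"
  shows "f differentiable (at x within S)"
proof -
  obtain W g where W: "open W" "x \<in> W" "\<forall>k. Ck_on k W g" "\<forall>y\<in>S \<inter> W. g y = f y"
    using bspec[OF assms(1)[unfolded smooth_on_def] assms(2)] by auto
  have "Ck_on (Suc 0) W g" using W(3) by (rule spec)
  then have "(g has_derivative frechet_derivative g (at x)) (at x within S)"
    by (rule has_derivative_at_withinI[OF Ck_on_Suc_derivative[OF _ W(1,2)]])
  moreover from W(1,2) obtain d where d: "d > 0" "\<And>y. dist y x < d \<Longrightarrow> y \<in> W"
    unfolding open_dist by blast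
  note d(1)
  moreover have "g y = f y" if "y \<in> S" "dist y x < d" for y
    using W(4) d(2) that by simp
  ultimately have "(f has_derivative frechet_derivative g (at x)) (at x within S)"
    by (rule has_derivative_transform_within[OF _ _ assms(2)])
  then show ?thesis by (auto simp: differentiable_def)
qed

lemma smooth_on_continuous_on: "smooth_on S f \<Longrightarrow> continuous_on S f"
  unfolding continuous_on_eq_continuous_within
  by (intro ballI differentiable_imp_continuous_within smooth_on_differentiable_within)

lemma smooth_on_continuous_derivative:
  assumes "smooth_on S f" "open S"
  shows "continuous_on S (\<lambda>x. frechet_derivative f (at x) v)"
  unfolding continuous_on_eq_continuous_at[OF assms(2)]
proof
  fix x assume x: "x \<in> S"
  obtain W g where W: "open W" "x \<in> W" "\<forall>k. Ck_on k W g" "\<forall>y\<in>S \<inter> W. g y = f y"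
    using bspec[OF assms(1)[unfolded smooth_on_def] x] by auto
  have Ck: "Ck_on (Suc 0) W g" using W(3) by (rule spec)
  have eq: "frechet_derivative g (at y) = frechet_derivative f (at y)" if "y \<in> S \<inter> W" for y
  proof -
    have "(g has_derivative frechet_derivative g (at y)) (at y)"
      using that by (intro Ck_on_Suc_derivative[OF Ck W(1)]) auto
    then have "(f has_derivative frechet_derivative g (at y)) (at y)"
      by (rule has_derivative_transform_within_open[where s = "S \<inter> W"]) (use W(1,4) assms(2) that in auto)
    then show ?thesis by (rule frechet_derivative_at)
  qed
  have "continuous_on W (\<lambda>x. frechet_derivative g (at x) v)"
    using Ck by simp
  then have "continuous_on (S \<inter> W) (\<lambda>x. frechet_derivative g (at x) v)"
    by (rule continuous_on_subset) auto
  then have "continuous_on (S \<inter> W) (\<lambda>x. frechet_derivative f (at x) v)"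
    by (rule continuous_on_eq) (simp add: eq)
  then show "isCont (\<lambda>x. frechet_derivative f (at x) v) x"
    using W(1,2) \<open>x \<in> S\<close> assms(2) by (simp add: continuous_on_eq_continuous_at open_Int)
qed

lemma smooth_on_has_derivative:
  assumes "smooth_on S f" "open S" "x \<in> S"
  shows "(f has_derivative frechet_derivative f (at x)) (at x)"
  using smooth_on_differentiable_within[OF assms(1,3)]
  unfolding at_within_open[OF assms(3,2)] frechet_derivative_works .

text \<open>Smoothness is given in terms of the directional derivatives in fixed directions. In finite dimension this
  implies joint continuity in point and direction, which is needed for the velocity of a curve in another chart.\<close>

lemma tendsto_derivative_apply:
  fixes f :: "'a::euclidean_space \<Rightarrow> 'b::real_normed_vector"
  assumes f: "smooth_on S f" "open S" and "x t \<in> S" "(x \<longlongrightarrow> x t) F" "(v \<longlongrightarrow> v t) F"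
  shows "((\<lambda>u. frechet_derivative f (at (x u)) (v u)) \<longlongrightarrow> frechet_derivative f (at (x t)) (v t)) F"
proof -
  have expand: "frechet_derivative f (at y) w = (\<Sum>b\<in>Basis. (w \<bullet> b) *\<^sub>R frechet_derivative f (at y) b)"
    if "y \<in> S" for y w
  proof -
    have "linear (frechet_derivative f (at y))"
      using smooth_on_has_derivative[OF f that] by (rule has_derivative_linear)
    then have "frechet_derivative f (at y) (\<Sum>b\<in>Basis. (w \<bullet> b) *\<^sub>R b)
        = (\<Sum>b\<in>Basis. (w \<bullet> b) *\<^sub>R frechet_derivative f (at y) b)"
      by (simp add: linear_sum linear_scale)
    then show ?thesis by (simp add: euclidean_representation)
  qed
  have lim: "((\<lambda>u. \<Sum>b\<in>Basis. (v u \<bullet> b) *\<^sub>R frechet_derivative f (at (x u)) b) \<longlongrightarrow>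
      (\<Sum>b\<in>Basis. (v t \<bullet> b) *\<^sub>R frechet_derivative f (at (x t)) b)) F"
  proof (intro tendsto_sum tendsto_scaleR tendsto_inner tendsto_const assms(5))
    show "((\<lambda>u. frechet_derivative f (at (x u)) b) \<longlongrightarrow> frechet_derivative f (at (x t)) b) F" for b
      using smooth_on_continuous_derivative[OF f] assms(3) f(2)
      by (intro isCont_tendsto_compose[OF _ assms(4)]) (simp add: continuous_on_eq_continuous_at)
  qed
  have ev: "\<forall>\<^sub>F u in F. (\<Sum>b\<in>Basis. (v u \<bullet> b) *\<^sub>R frechet_derivative f (at (x u)) b)
      = frechet_derivative f (at (x u)) (v u)"
    using topological_tendstoD[OF assms(4) f(2) assms(3)]
    by (rule eventually_mono) (rule expand[symmetric])
  show ?thesis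
    using Lim_transform_eventually[OF lim ev] unfolding expand[OF assms(3), of "v t", symmetric] .
qed

lemma is_chart_inj_on: "is_chart (U, \<phi>) \<Longrightarrow> inj_on \<phi> U"
  unfolding is_chart_def homeomorphism_def by (auto intro: inj_on_inverseI)

lemma is_chart_open: "is_chart (U, \<phi>) \<Longrightarrow> open U"
  unfolding is_chart_def by auto

lemma is_chart_continuous_on: "is_chart (U, \<phi>) \<Longrightarrow> continuous_on U \<phi>"
  unfolding is_chart_def homeomorphism_def by auto

lemma is_chart_homeomorphism: "is_chart (U, \<phi>) \<Longrightarrow> homeomorphism U (\<phi> ` U) \<phi> (inv_into U \<phi>)"
proof -
  assume c: "is_chart (U, \<phi>)"
  then obtain \<psi> where h: "homeomorphism U (\<phi> ` U) \<phi> \<psi>" unfolding is_chart_def by auto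
  have "inv_into U \<phi> y = \<psi> y" if "y \<in> \<phi> ` U" for y
    using h that is_chart_inj_on[OF c] unfolding homeomorphism_def by (auto simp: inv_into_f_f)
  then show ?thesis using h
    unfolding homeomorphism_def by (auto cong: continuous_on_cong)
qed

lemma curve_stays:
  assumes "continuous_on {a..b} \<gamma>" "t \<in> {a..b}" "open W" "\<gamma> t \<in> W"
  obtains d :: real where "d > 0" "\<And>u. u \<in> {a..b} \<Longrightarrow> \<bar>u - t\<bar> < d \<Longrightarrow> \<gamma> u \<in> W"
proof -
  have "(\<gamma> \<longlongrightarrow> \<gamma> t) (at t within {a..b})"
    using assms(1,2) by (simp add: continuous_on_def)
  then have "\<forall>\<^sub>F u in at t within {a..b}. \<gamma> u \<in> W"
    using assms(3,4) by (rule topological_tendstoD)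
  then obtain d where d: "d > 0" "\<forall>u\<in>{a..b}. u \<noteq> t \<and> dist u t < d \<longrightarrow> \<gamma> u \<in> W"
    unfolding eventually_at by blast
  show ?thesis
    by (rule that[OF d(1)]) (use d(2) assms(4) in \<open>auto simp: dist_real_def\<close>)
qed

lemma has_vector_derivative_compose_has_derivative:
  assumes "(f has_vector_derivative v) (at t within S)" "(g has_derivative g') (at (f t))"
  shows "((g \<circ> f) has_vector_derivative g' v) (at t within S)"
proof -
  have "linear g'" using assms(2) by (rule has_derivative_linear)
  have "((g \<circ> f) has_derivative (g' \<circ> (\<lambda>h. h *\<^sub>R v))) (at t within S)"
    by (rule diff_chain_within[OF assms(1)[unfolded has_vector_derivative_def] has_derivative_at_withinI[OF assms(2)]])
  also have "g' \<circ> (\<lambda>h. h *\<^sub>R v) = (\<lambda>h. h *\<^sub>R g' v)"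
    using linear_scale[OF \<open>linear g'\<close>] by (simp add: fun_eq_iff)
  finally show ?thesis unfolding has_vector_derivative_def .
qed

text \<open>A critical endpoint \<open>a\<close> or \<open>b\<close> has no timelike velocity. The velocities with respect to
  the two intervals are therefore compared only at noncritical parameters, which suffices, since near each parameter
  \<open>t\<close> all others are interior points of \<open>[a, b]\<close>.\<close>

lemma timelike_piece_restrict:
  assumes piece: "timelike_piece X s \<gamma> a b" and charts: "\<And>c. c \<in> atlas X \<Longrightarrow> open (fst c)"
    and c: "a \<le> c" "c < b"
  shows "timelike_piece X s \<gamma> c b"
proof -
  have cont: "continuous_on {a..b} \<gamma>"
    and ncrit: "\<And>t. t \<in> {a<..<b} \<Longrightarrow> \<not> critical (atlas X) (morse X) (\<gamma> t)"
    and tl: "\<And>t. t \<in> {a..b} \<Longrightarrow> \<not> critical (atlas X) (morse X) (\<gamma> t) \<Longrightarrow> timelike_at X s \<gamma> {a..b} t"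
    using piece unfolding timelike_piece_def by blast+
  have sub: "{c..b} \<subseteq> {a..b}" using c by auto
  have vel: "((snd d \<circ> \<gamma>) has_vector_derivative velocity d \<gamma> {a..b} t) (at t within {c..b})
      \<and> velocity d \<gamma> {c..b} t = velocity d \<gamma> {a..b} t"
    if "d \<in> atlas X" "t \<in> {c..b}" "\<gamma> t \<in> fst d" "\<not> critical (atlas X) (morse X) (\<gamma> t)" for d t
  proof -
    have "timelike_at X s \<gamma> {a..b} t" using tl sub that(2,4) by blast
    then have "(snd d \<circ> \<gamma>) differentiable (at t within {a..b})"
      using that(1,3) unfolding timelike_at_def by blast
    then have "((snd d \<circ> \<gamma>) has_vector_derivative velocity d \<gamma> {a..b} t) (at t within {a..b})"
      unfolding velocity_def vector_derivative_works .
    then have 1: "((snd d \<circ> \<gamma>) has_vector_derivative velocity d \<gamma> {a..b} t) (at t within {c..b})"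
      by (rule has_vector_derivative_within_subset[OF _ sub])
    then show ?thesis
      using vector_derivative_within_closed_interval[OF c(2) that(2) 1] by (simp add: velocity_def)
  qed
  have "timelike_at X s \<gamma> {c..b} t" if t: "t \<in> {c..b}" "\<not> critical (atlas X) (morse X) (\<gamma> t)" for t
    unfolding timelike_at_def
  proof (intro ballI impI conjI)
    fix d assume d: "d \<in> atlas X" "\<gamma> t \<in> fst d"
    have tl_t: "timelike_at X s \<gamma> {a..b} t" using tl sub t by blast
    note vel_t = vel[OF d(1) t(1) d(2) t(2)]
    show "(snd d \<circ> \<gamma>) differentiable (at t within {c..b})"
      using vel_t differentiableI_vector by blast
    show "timelike X s d (\<gamma> t) (velocity d \<gamma> {c..b} t)"
      using vel_t tl_t d unfolding timelike_at_def by simp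
    have "continuous (at t within {a..b}) (velocity d \<gamma> {a..b})"
      using tl_t d unfolding timelike_at_def by blast
    then have "continuous (at t within {c..b}) (velocity d \<gamma> {a..b})"
      by (rule continuous_within_subset[OF _ sub])
    then have lim: "(velocity d \<gamma> {a..b} \<longlongrightarrow> velocity d \<gamma> {c..b} t) (at t within {c..b})"
      using vel_t by (simp add: continuous_within)
    have "(\<gamma> \<longlongrightarrow> \<gamma> t) (at t within {c..b})"
      using continuous_on_subset[OF cont sub] t(1) by (simp add: continuous_on_def)
    then have "\<forall>\<^sub>F u in at t within {c..b}. \<gamma> u \<in> fst d"
      using charts[OF d(1)] d(2) by (rule topological_tendstoD)
    moreover have "\<forall>\<^sub>F u in at t within {c..b}. u \<in> {c..b} \<and> u \<noteq> t"
      by (simp add: eventually_at_filter)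
    moreover have "\<forall>\<^sub>F u in at t within {c..b}. u \<noteq> a \<or> t = a"
      by (cases "t = a") (auto intro: tendsto_imp_eventually_ne tendsto_ident_at)
    moreover have "\<forall>\<^sub>F u in at t within {c..b}. u \<noteq> b \<or> t = b"
      by (cases "t = b") (auto intro: tendsto_imp_eventually_ne tendsto_ident_at)
    ultimately have "\<forall>\<^sub>F u in at t within {c..b}. velocity d \<gamma> {a..b} u = velocity d \<gamma> {c..b} u"
    proof eventually_elim
      case (elim u)
      then have "u \<in> {a<..<b}" using sub by force
      then show ?case using vel[OF d(1), of u] ncrit elim by auto
    qed
    from Lim_transform_eventually[OF lim this]
    show "continuous (at t within {c..b}) (velocity d \<gamma> {c..b})"
      by (simp add: continuous_within)
  qed
  moreover have "\<not> critical (atlas X) (morse X) (\<gamma> t)" if "t \<in> {c<..<b}" for t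
    using ncrit c that by auto
  ultimately show ?thesis
    using c(2) continuous_on_subset[OF cont sub] unfolding timelike_piece_def by blast
qed

section \<open>General Morse spacetimes\<close>

locale morse_spacetime =
  fixes X :: "('m::{t2_space,second_countable_topology}, 'e::euclidean_space) morse_data"
  assumes conditions: "morse_conditions X"
begin

lemma smooth_structure: "smooth_structure (atlas X)"
  and riemannian: "riemannian_metric (atlas X) (metric X)"
  and smooth_morse: "smooth_function (atlas X) (morse X)"
  using conditions unfolding morse_conditions_def morse_function_def by blast+

lemma atlas_is_chart: "(V, \<psi>) \<in> atlas X \<Longrightarrow> is_chart (V, \<psi>)"
  using smooth_structure unfolding smooth_structure_def by blast

lemma morse_differentiable:
  assumes "(V, \<psi>) \<in> atlas X" "z \<in> V"
  shows "((morse X \<circ> inv_into V \<psi>) has_derivative diff_coord (V, \<psi>) (morse X) z) (at (\<psi> z) within \<psi> ` V)"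
proof -
  have "smooth_on (\<psi> ` V) (morse X \<circ> inv_into V \<psi>)"
    using bspec[OF smooth_morse[unfolded smooth_function_def] assms(1)] by simp
  then have "(morse X \<circ> inv_into V \<psi>) differentiable (at (\<psi> z) within \<psi> ` V)"
    by (rule smooth_on_differentiable_within) (use assms in simp)
  then show ?thesis
    unfolding frechet_derivative_works diff_coord_def prod.case .
qed

lemma gradient_eqI:
  assumes "c \<in> atlas X" "z \<in> fst c" "\<And>v. metric X c z u v = diff_coord c (morse X) z v"
  shows "gradient X c z = u"
  unfolding gradient_def
proof (rule the_equality)
  show "\<forall>v. metric X c z u v = diff_coord c (morse X) z v" using assms by blast
next
  fix u' assume u': "\<forall>v. metric X c z u' v = diff_coord c (morse X) z v"
  have bil: "bilinear (metric X c z)" and pos: "\<And>v. v \<noteq> 0 \<Longrightarrow> 0 < metric X c z v v"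
    using riemannian assms(1,2) unfolding riemannian_metric_def by blast+
  have "metric X c z (u' - u) (u' - u) = 0"
    using u' assms(3) by (simp add: bilinear_lsub[OF bil])
  then show "u' = u" using pos[of "u' - u"] by fastforce
qed

text \<open>This holds on the whole manifold and for pieces with critical endpoints, so it also controls the parts of a
  curve that run outside of a given chart.\<close>

lemma morse_decreasing:
  assumes piece: "timelike_piece X (-1) \<gamma> a b" and st: "a \<le> s" "s \<le> t" "t \<le> b"
  shows "morse X (\<gamma> t) \<le> morse X (\<gamma> s)"
proof (cases "s = t")
  case False
  have cont: "continuous_on {a..b} \<gamma>" using piece by (simp add: timelike_piece_def)
  have chart_at: "\<exists>V \<psi>. (V, \<psi>) \<in> atlas X \<and> z \<in> V" for z
  proof -
    have "z \<in> (\<Union>c\<in>atlas X. fst c)" using smooth_structure unfolding smooth_structure_def by simp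
    then show ?thesis by force
  qed
  have eq: "(morse X \<circ> inv_into V \<psi>) (\<psi> z) = morse X z" if "(V, \<psi>) \<in> atlas X" "z \<in> V" for V \<psi> z
    using is_chart_inj_on[OF atlas_is_chart[OF that(1)]] that(2) by simp
  have "isCont (morse X) z" for z
  proof -
    obtain V \<psi> where V: "(V, \<psi>) \<in> atlas X" "z \<in> V" using chart_at by blast
    have "continuous_on (\<psi> ` V) (morse X \<circ> inv_into V \<psi>)"
      using bspec[OF smooth_morse[unfolded smooth_function_def] V(1)]
      by (intro smooth_on_continuous_on) simp
    then have "continuous_on V ((morse X \<circ> inv_into V \<psi>) \<circ> \<psi>)"
      by (rule continuous_on_compose[OF is_chart_continuous_on[OF atlas_is_chart[OF V(1)]]])
    then have "continuous_on V (morse X)"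
      by (rule continuous_on_eq) (use eq[OF V(1)] in simp)
    then show ?thesis
      using V(2) is_chart_open[OF atlas_is_chart[OF V(1)]] by (simp add: continuous_on_eq_continuous_at)
  qed
  then have cont_f: "continuous_on {a..b} (morse X \<circ> \<gamma>)"
    by (intro continuous_on_compose[OF cont] continuous_at_imp_continuous_on ballI)
  have deriv: "\<exists>y. DERIV (morse X \<circ> \<gamma>) u :> y \<and> y < 0" if "s < u" "u < t" for u
  proof -
    have u: "u \<in> {a<..<b}" using that st by auto
    obtain V \<psi> where V: "(V, \<psi>) \<in> atlas X" "\<gamma> u \<in> V" using chart_at by blast
    have oV: "open V" by (rule is_chart_open[OF atlas_is_chart[OF V(1)]])
    have at_u: "at u within {a..b} = at u" using u by (simp add: at_within_Icc_at)
    have "timelike_at X (-1) \<gamma> {a..b} u"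
      using piece u unfolding timelike_piece_def by auto
    from bspec[OF this[unfolded timelike_at_def] V(1)]
    have d: "(\<psi> \<circ> \<gamma>) differentiable (at u)"
      and tl: "timelike X (-1) (V, \<psi>) (\<gamma> u) (velocity (V, \<psi>) \<gamma> {a..b} u)"
      using V(2) at_u by simp_all
    define v where "v = velocity (V, \<psi>) \<gamma> {a..b} u"
    have v: "((\<psi> \<circ> \<gamma>) has_derivative (\<lambda>h. h *\<^sub>R v)) (at u)"
      using d unfolding vector_derivative_works v_def velocity_def at_u has_vector_derivative_def by simp
    let ?F = "diff_coord (V, \<psi>) (morse X) (\<gamma> u)"
    define N where "N = {a<..<b} \<inter> \<gamma> -` V"
    have "continuous_on {a<..<b} \<gamma>" using cont by (rule continuous_on_subset) auto
    then have N: "open N" "u \<in> N"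
      using oV u V(2) unfolding N_def by (auto intro: continuous_open_preimage)
    have F: "((morse X \<circ> inv_into V \<psi>) has_derivative ?F) (at ((\<psi> \<circ> \<gamma>) u) within (\<psi> \<circ> \<gamma>) ` N)"
      by (rule has_derivative_subset) (use morse_differentiable[OF V] in \<open>auto simp: N_def\<close>)
    have lin: "linear ?F" using F by (rule has_derivative_linear)
    have chain: "((morse X \<circ> inv_into V \<psi>) \<circ> (\<psi> \<circ> \<gamma>) has_derivative ?F \<circ> (\<lambda>h. h *\<^sub>R v)) (at u within N)"
      by (rule diff_chain_within[OF has_derivative_at_withinI[OF v] F])
    have "(morse X \<circ> \<gamma>) w = ((morse X \<circ> inv_into V \<psi>) \<circ> (\<psi> \<circ> \<gamma>)) w" if "w \<in> N" for w
      using eq[OF V(1), of "\<gamma> w"] that by (simp add: N_def)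
    from has_derivative_transform[OF N(2) this chain]
    have "(morse X \<circ> \<gamma> has_derivative ?F \<circ> (\<lambda>h. h *\<^sub>R v)) (at u)"
      unfolding at_within_open[OF N(2,1)] .
    moreover have "?F \<circ> (\<lambda>h. h *\<^sub>R v) = (*) (?F v)"
      using linear_scale[OF lin] by (simp add: fun_eq_iff mult.commute)
    ultimately have "DERIV (morse X \<circ> \<gamma>) u :> ?F v"
      by (simp add: has_field_derivative_def)
    moreover have "?F v < 0" using tl by (simp add: timelike_def v_def)
    ultimately show ?thesis by blast
  qed
  have "(morse X \<circ> \<gamma>) t < (morse X \<circ> \<gamma>) s"
  proof (rule DERIV_neg_imp_decreasing_open[of s t "morse X \<circ> \<gamma>"])
    show "s < t" using False st by simp
    show "continuous_on {s..t} (morse X \<circ> \<gamma>)"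
      using cont_f by (rule continuous_on_subset) (use st in auto)
  qed (use deriv in blast)
  then show ?thesis by simp
qed simp

end

section \<open>Timelike curves in the Euclidean chart\<close>

locale euclidean_chart = morse_spacetime X
  for X :: "('m::{t2_space,second_countable_topology}, real^4) morse_data" +
  fixes U :: "'m set" and \<phi> :: "'m \<Rightarrow> real^4"
  assumes chart: "admits_local_chart X (U, \<phi>) euclidean_h anisotropic_f 2"
begin

abbreviation (input) "emb \<equiv> inv_into U \<phi>"

lemma in_atlas: "(U, \<phi>) \<in> atlas X" and open_image: "open (\<phi> ` U)" and zeta_eq: "zeta X = 2"
  and metric_eq: "z \<in> U \<Longrightarrow> metric X (U, \<phi>) z v w = v \<bullet> w"
  and morse_eq: "z \<in> U \<Longrightarrow> morse X z = anisotropic_f (\<phi> z)"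
  using chart unfolding admits_local_chart_def by (auto simp: euclidean_h_eq_inner)

lemmas chart_homeo = is_chart_homeomorphism[OF atlas_is_chart[OF in_atlas]]
lemmas open_U = is_chart_open[OF atlas_is_chart[OF in_atlas]]
lemmas continuous_chart = is_chart_continuous_on[OF atlas_is_chart[OF in_atlas]]

lemma emb_chart [simp]: "z \<in> U \<Longrightarrow> emb (\<phi> z) = z"
  using chart_homeo by (simp add: homeomorphism_def)

lemma chart_emb [simp]: "x \<in> \<phi> ` U \<Longrightarrow> \<phi> (emb x) = x"
  by (rule f_inv_into_f)

lemma emb_in [simp]: "x \<in> \<phi> ` U \<Longrightarrow> emb x \<in> U"
  by (rule inv_into_into)

lemma continuous_emb: "continuous_on (\<phi> ` U) emb"
  using chart_homeo by (simp add: homeomorphism_def)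

lemma diff_coord_eq:
  assumes "z \<in> U" shows "diff_coord (U, \<phi>) (morse X) z v = grad_f (\<phi> z) \<bullet> v"
proof -
  have "(anisotropic_f has_derivative (\<lambda>v. grad_f (\<phi> z) \<bullet> v)) (at (\<phi> z))"
    by (rule has_derivative_anisotropic_f)
  then have "((morse X \<circ> emb) has_derivative (\<lambda>v. grad_f (\<phi> z) \<bullet> v)) (at (\<phi> z))"
    by (rule has_derivative_transform_within_open[where s = "\<phi> ` U"])
       (use open_image assms morse_eq in \<open>auto\<close>)
  then have "frechet_derivative (morse X \<circ> emb) (at (\<phi> z)) = (\<lambda>v. grad_f (\<phi> z) \<bullet> v)"
    by (rule frechet_derivative_at[symmetric])
  then show ?thesis
    using assms at_within_open[OF _ open_image, of "\<phi> z"] by (simp add: diff_coord_def)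
qed

lemma timelike_iff_timelike_cone:
  assumes "z \<in> U"
  shows "timelike X s (U, \<phi>) z v \<longleftrightarrow> timelike_cone s (\<phi> z) v"
proof -
  have "gradient X (U, \<phi>) z = grad_f (\<phi> z)"
    by (rule gradient_eqI[OF in_atlas]) (use assms in \<open>auto simp: metric_eq diff_coord_eq\<close>)
  then show ?thesis
    using assms unfolding timelike_def lorentz_metric_def timelike_cone_def
    by (simp add: metric_eq diff_coord_eq zeta_eq power2_eq_square algebra_simps)
qed

lemma not_critical:
  assumes "z \<in> U" "\<phi> z \<noteq> 0"
  shows "\<not> critical (atlas X) (morse X) z"
proof
  assume "critical (atlas X) (morse X) z"
  then have "diff_coord (U, \<phi>) (morse X) z v = 0" for v
    using in_atlas assms(1) unfolding critical_def by simp
  then have "grad_f (\<phi> z) \<bullet> v = 0" for v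
    unfolding diff_coord_eq[OF assms(1)] .
  from this[of "grad_f (\<phi> z)"] show False
    using assms(2) by (simp add: vec_eq_iff_4)
qed

lemma transition_smooth:
  assumes "(V, \<psi>) \<in> atlas X"
  shows "smooth_on (\<phi> ` (U \<inter> V)) (\<psi> \<circ> emb)"
proof -
  have "compatible (U, \<phi>) (V, \<psi>)"
    using smooth_structure assms in_atlas unfolding smooth_structure_def by blast
  then show ?thesis by (simp add: compatible_def transition_def)
qed

lemma open_overlap:
  assumes "(V, \<psi>) \<in> atlas X"
  shows "open (\<phi> ` (U \<inter> V))"
proof -
  have "openin (top_of_set U) (U \<inter> V)"
    using is_chart_open[OF atlas_is_chart[OF assms]] by (simp add: openin_open_Int)
  then have "openin (top_of_set (\<phi> ` U)) (\<phi> ` (U \<inter> V))"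
    using homeomorphism_imp_open_map[OF chart_homeo] by blast
  then show ?thesis using open_image openin_open_trans by blast
qed

lemma metric_transform:
  assumes "(V, \<psi>) \<in> atlas X" "z \<in> U" "z \<in> V"
  defines "T \<equiv> frechet_derivative (\<psi> \<circ> emb) (at (\<phi> z))"
  shows "v \<bullet> w = metric X (V, \<psi>) z (T v) (T w)"
proof -
  have "at (\<phi> z) within \<phi> ` (U \<inter> V) = at (\<phi> z)"
    by (rule at_within_open[OF _ open_overlap[OF assms(1)]]) (use assms in simp)
  moreover have "let T = frechet_derivative (transition (U, \<phi>) (V, \<psi>)) (at (snd (U, \<phi>) z) within snd (U, \<phi>) ` (fst (U, \<phi>) \<inter> fst (V, \<psi>)))
        in \<forall>v w. metric X (U, \<phi>) z v w = metric X (V, \<psi>) z (T v) (T w)"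
    using riemannian assms(2,3)
    by (intro bspec[OF bspec[OF bspec[OF conjunct2[OF conjunct2[OF riemannian[unfolded riemannian_metric_def]]]
          in_atlas] assms(1)]]) simp
  ultimately show ?thesis
    using assms(2) by (simp add: T_def transition_def Let_def metric_eq)
qed

lemma diff_transform:
  assumes "(V, \<psi>) \<in> atlas X" "z \<in> U" "z \<in> V"
  defines "T \<equiv> frechet_derivative (\<psi> \<circ> emb) (at (\<phi> z))"
  shows "grad_f (\<phi> z) \<bullet> v = diff_coord (V, \<psi>) (morse X) z (T v)"
proof -
  let ?O = "\<phi> ` (U \<inter> V)"
  have O: "\<phi> z \<in> ?O" "open ?O" using assms open_overlap by auto
  have "((\<psi> \<circ> emb) has_derivative T) (at (\<phi> z) within ?O)"
    unfolding T_def by (rule has_derivative_at_withinI, rule smooth_on_has_derivative[OF transition_smooth])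
      (use assms O in auto)
  moreover have "((morse X \<circ> inv_into V \<psi>) has_derivative diff_coord (V, \<psi>) (morse X) z)
      (at ((\<psi> \<circ> emb) (\<phi> z)) within (\<psi> \<circ> emb) ` ?O)"
    by (rule has_derivative_subset) (use morse_differentiable[OF assms(1,3)] assms(2,3) in auto)
  ultimately have chain: "(((morse X \<circ> inv_into V \<psi>) \<circ> (\<psi> \<circ> emb)) has_derivative
      (diff_coord (V, \<psi>) (morse X) z \<circ> T)) (at (\<phi> z) within ?O)"
    by (rule diff_chain_within)
  have "(morse X \<circ> emb) x = ((morse X \<circ> inv_into V \<psi>) \<circ> (\<psi> \<circ> emb)) x" if "x \<in> ?O" for x
    using that is_chart_inj_on[OF atlas_is_chart[OF assms(1)]] by auto
  from has_derivative_transform[OF O(1) this chain]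
  have "((morse X \<circ> emb) has_derivative (diff_coord (V, \<psi>) (morse X) z \<circ> T)) (at (\<phi> z) within ?O)" .
  then have "((morse X \<circ> emb) has_derivative (diff_coord (V, \<psi>) (morse X) z \<circ> T)) (at (\<phi> z))"
    unfolding at_within_open[OF O] .
  moreover have "((morse X \<circ> emb) has_derivative diff_coord (U, \<phi>) (morse X) z) (at (\<phi> z))"
    using morse_differentiable[OF in_atlas assms(2)] assms(2) at_within_open[OF _ open_image, of "\<phi> z"] by simp
  ultimately have "diff_coord (V, \<psi>) (morse X) z \<circ> T = diff_coord (U, \<phi>) (morse X) z"
    by (rule has_derivative_unique)
  then show ?thesis using assms(2) using diff_coord_eq[OF assms(2), of v] by (auto simp: fun_eq_iff)
qed

text \<open>The transition map preserves the metric and the differential of \<open>f\<close>, hence also the gradient. Its derivative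
  \<open>T\<close> is injective because the metric is positive definite, and thus bijective by dimension; this makes
  \<open>T (\<nabla>f)\<close> the gradient in the other chart.\<close>

lemma timelike_transform:
  assumes "(V, \<psi>) \<in> atlas X" "z \<in> U" "z \<in> V"
  defines "T \<equiv> frechet_derivative (\<psi> \<circ> emb) (at (\<phi> z))"
  shows "timelike X s (V, \<psi>) z (T v) \<longleftrightarrow> timelike_cone s (\<phi> z) v"
proof -
  note metric_T = metric_transform[OF assms(1-3), folded T_def]
  note diff_T = diff_transform[OF assms(1-3), folded T_def]
  have bil: "bilinear (metric X (V, \<psi>) z)"
    using bspec[OF bspec[OF conjunct1[OF riemannian[unfolded riemannian_metric_def]] assms(1)]] assms(3) by simp
  have "linear T"
    unfolding T_def using smooth_on_has_derivative[OF transition_smooth[OF assms(1)] open_overlap[OF assms(1)]] assms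
    by (blast intro: has_derivative_linear)
  moreover have "inj T"
  proof -
    have "v = 0" if "T v = 0" for v
      using metric_T[of v v] that by (simp add: bilinear_lzero[OF bil])
    then show ?thesis using \<open>linear T\<close> linear_injective_0 by blast
  qed
  ultimately have "surj T" by (rule linear_injective_imp_surjective) simp
  have grad: "gradient X (V, \<psi>) z = T (grad_f (\<phi> z))"
  proof (rule gradient_eqI[OF assms(1)])
    fix v
    obtain w where "v = T w" using \<open>surj T\<close> unfolding surj_def by blast
    then show "metric X (V, \<psi>) z (T (grad_f (\<phi> z))) v = diff_coord (V, \<psi>) (morse X) z v"
      using metric_T diff_T by simp
  qed (use assms in simp)
  show ?thesis
    unfolding timelike_def lorentz_metric_def timelike_cone_def grad metric_T[symmetric] diff_T[symmetric] zeta_eq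
    by (simp add: power2_eq_square algebra_simps)
qed

text \<open>The definition of a timelike piece refers to all charts of the atlas; it suffices to check the curve in the
  Euclidean one.\<close>

lemma timelike_piece_of_chart_curve:
  assumes ab: "a < b" and image: "\<And>t. t \<in> {a..b} \<Longrightarrow> x t \<in> \<phi> ` U"
    and deriv: "\<And>t. t \<in> {a..b} \<Longrightarrow> (x has_vector_derivative x' t) (at t within {a..b})"
    and cont: "continuous_on {a..b} x'"
    and timelike_cone: "\<And>t. t \<in> {a..b} \<Longrightarrow> timelike_cone s (x t) (x' t)"
  shows "timelike_piece X s (emb \<circ> x) a b"
proof -
  have cont_x: "continuous_on {a..b} x"
    unfolding continuous_on_eq_continuous_within
    using has_vector_derivative_continuous[OF deriv] by blast
  have ncrit: "\<not> critical (atlas X) (morse X) ((emb \<circ> x) t)" if "t \<in> {a..b}" for t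
    using image[OF that] timelike_cone_nonzero[OF timelike_cone[OF that]] by (intro not_critical) auto
  have tl: "timelike_at X s (emb \<circ> x) {a..b} t" if t: "t \<in> {a..b}" for t
    unfolding timelike_at_def
  proof (intro ballI impI)
    fix c assume c: "c \<in> atlas X" "(emb \<circ> x) t \<in> fst c"
    obtain V \<psi> where c_eq: "c = (V, \<psi>)" by (cases c)
    let ?O = "\<phi> ` (U \<inter> V)"
    let ?T = "\<lambda>y. frechet_derivative (\<psi> \<circ> emb) (at y)"
    have V: "(V, \<psi>) \<in> atlas X" using c c_eq by simp
    have O: "open ?O" by (rule open_overlap[OF V])
    have xt: "x t \<in> ?O"
      using image[OF t] c(2) c_eq by (metis IntI chart_emb comp_apply emb_in fst_conv image_eqI)
    have vel: "((\<psi> \<circ> (emb \<circ> x)) has_vector_derivative ?T (x u) (x' u)) (at u within {a..b})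
        \<and> velocity c (emb \<circ> x) {a..b} u = ?T (x u) (x' u)"
      if "u \<in> {a..b}" "x u \<in> ?O" for u
    proof -
      have "((\<psi> \<circ> emb \<circ> x) has_vector_derivative ?T (x u) (x' u)) (at u within {a..b})"
        using deriv[OF that(1)] smooth_on_has_derivative[OF transition_smooth[OF V] O that(2)]
        by (rule has_vector_derivative_compose_has_derivative)
      then have 1: "((\<psi> \<circ> (emb \<circ> x)) has_vector_derivative ?T (x u) (x' u)) (at u within {a..b})"
        by (simp add: o_assoc)
      then show ?thesis
        using vector_derivative_within_closed_interval[OF ab that(1) 1] by (simp add: velocity_def c_eq)
    qed
    have "(x \<longlongrightarrow> x t) (at t within {a..b})" "(x' \<longlongrightarrow> x' t) (at t within {a..b})"
      using cont_x cont t by (simp_all add: continuous_on_def)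
    then have lim: "((\<lambda>u. ?T (x u) (x' u)) \<longlongrightarrow> ?T (x t) (x' t)) (at t within {a..b})"
      by (rule tendsto_derivative_apply[where x = x and v = x' and t = t, OF transition_smooth[OF V] O xt])
    have "\<forall>\<^sub>F u in at t within {a..b}. x u \<in> ?O"
      using \<open>(x \<longlongrightarrow> x t) _\<close> O xt by (rule topological_tendstoD)
    moreover have "\<forall>\<^sub>F u in at t within {a..b}. u \<in> {a..b}"
      by (simp add: eventually_at_filter)
    ultimately have "\<forall>\<^sub>F u in at t within {a..b}. ?T (x u) (x' u) = velocity c (emb \<circ> x) {a..b} u"
      by eventually_elim (use vel in simp)
    from Lim_transform_eventually[OF lim this]
    have "continuous (at t within {a..b}) (velocity c (emb \<circ> x) {a..b})"
      using vel[OF t xt] by (simp add: continuous_within)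
    moreover have "timelike X s c ((emb \<circ> x) t) (velocity c (emb \<circ> x) {a..b} t)"
    proof -
      have "timelike X s (V, \<psi>) (emb (x t)) (frechet_derivative (\<psi> \<circ> emb) (at (\<phi> (emb (x t)))) (x' t))
          \<longleftrightarrow> timelike_cone s (\<phi> (emb (x t))) (x' t)"
        by (rule timelike_transform[OF V]) (use image[OF t] c c_eq in auto)
      then show ?thesis
        using vel[OF t xt] timelike_cone[OF t] image[OF t] by (simp add: c_eq)
    qed
    moreover have "(snd c \<circ> (emb \<circ> x)) differentiable (at t within {a..b})"
      using vel[OF t xt] differentiableI_vector by (auto simp: c_eq)
    ultimately show "(snd c \<circ> (emb \<circ> x)) differentiable (at t within {a..b}) \<and>
        continuous (at t within {a..b}) (velocity c (emb \<circ> x) {a..b}) \<and>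
        timelike X s c ((emb \<circ> x) t) (velocity c (emb \<circ> x) {a..b} t)"
      by blast
  qed
  have "continuous_on {a..b} (emb \<circ> x)"
    by (rule continuous_on_compose[OF cont_x continuous_on_subset[OF continuous_emb]]) (use image in blast)
  then show ?thesis
    unfolding timelike_piece_def using ab ncrit tl by auto
qed

lemma timelike_piece_in_chart:
  assumes "timelike_piece X s \<gamma> a b" "t \<in> {a..b}" "\<gamma> t \<in> U" "\<not> critical (atlas X) (morse X) (\<gamma> t)"
  obtains v where "((\<phi> \<circ> \<gamma>) has_vector_derivative v) (at t within {a..b})" "timelike_cone s (\<phi> (\<gamma> t)) v"
proof -
  have "timelike_at X s \<gamma> {a..b} t"
    using assms unfolding timelike_piece_def by blast
  from bspec[OF this[unfolded timelike_at_def] in_atlas]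
  have "(\<phi> \<circ> \<gamma>) differentiable (at t within {a..b})"
    and "timelike X s (U, \<phi>) (\<gamma> t) (velocity (U, \<phi>) \<gamma> {a..b} t)"
    using assms(3) by simp_all
  then show ?thesis
    using that timelike_iff_timelike_cone[OF assms(3)] unfolding vector_derivative_works velocity_def by simp
qed

lemma chart_function_decreasing:
  assumes piece: "timelike_piece X (-1) \<gamma> a b" and st: "a \<le> s" "s < t" "t \<le> b"
    and image: "\<And>u. u \<in> {s..t} \<Longrightarrow> \<gamma> u \<in> U"
    and F: "\<And>z. (F has_derivative F' z) (at z)" and neg: "\<And>z v. timelike_cone (-1) z v \<Longrightarrow> F' z v < (0::real)"
  shows "F (\<phi> (\<gamma> t)) < F (\<phi> (\<gamma> s))"
proof -
  have "continuous_on {a..b} \<gamma>" using piece by (simp add: timelike_piece_def)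
  then have "continuous_on {s..t} \<gamma>" by (rule continuous_on_subset) (use st in auto)
  then have "continuous_on {s..t} (\<phi> \<circ> \<gamma>)"
    by (rule continuous_on_compose[OF _ continuous_on_subset[OF continuous_chart]]) (use image in blast)
  moreover have "continuous_on A F" for A
    using has_derivative_continuous[OF F] by (simp add: continuous_at_imp_continuous_on)
  ultimately have cont: "continuous_on {s..t} (F \<circ> (\<phi> \<circ> \<gamma>))"
    by (rule continuous_on_compose)
  have deriv: "\<exists>y. DERIV (F \<circ> (\<phi> \<circ> \<gamma>)) u :> y \<and> y < 0" if "s < u" "u < t" for u
  proof -
    have u: "u \<in> {a<..<b}" using that st by auto
    have "\<not> critical (atlas X) (morse X) (\<gamma> u)"
      using piece u unfolding timelike_piece_def by blast
    moreover have "u \<in> {a..b}" "\<gamma> u \<in> U"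
      using u image[of u] that by auto
    ultimately obtain v where v: "((\<phi> \<circ> \<gamma>) has_vector_derivative v) (at u within {a..b})" "timelike_cone (-1) (\<phi> (\<gamma> u)) v"
      using timelike_piece_in_chart[OF piece] by blast
    have at_u: "at u within {a..b} = at u" using u by (simp add: at_within_Icc_at)
    have "(F \<circ> (\<phi> \<circ> \<gamma>) has_vector_derivative F' (\<phi> (\<gamma> u)) v) (at u)"
      using has_vector_derivative_compose_has_derivative[OF v(1)[unfolded at_u], of F "F' (\<phi> (\<gamma> u))"] F by simp
    then show ?thesis
      using neg[OF v(2)] by (auto simp: has_real_derivative_iff_has_vector_derivative)
  qed
  have "(F \<circ> (\<phi> \<circ> \<gamma>)) t < (F \<circ> (\<phi> \<circ> \<gamma>)) s"
    by (rule DERIV_neg_imp_decreasing_open[OF st(2) _ cont]) (use deriv in blast)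
  then show ?thesis by simp
qed

end

section \<open>A past-invariant set\<close>

text \<open>The part of the chart in which past curves from \<open>p\<close> are caught: in \<open>\<tau> \<le> 0\<close> and not on
  the side of \<open>q\<close> of the barrier.\<close>

definition trapped :: "real \<Rightarrow> real \<Rightarrow> real^4 \<Rightarrow> bool" where
  "trapped \<rho> d z \<longleftrightarrow> norm z < \<rho> \<and> tau z \<le> 0 \<and> radial_plus z \<le> d \<and> \<not> (0 \<le> barrier_lin z \<and> 0 \<le> barrier_quad z)"

lemma continuous_on_barrier_lin: "continuous_on A barrier_lin" and continuous_on_barrier_quad: "continuous_on A barrier_quad"
  unfolding barrier_quad_def[abs_def] barrier_lin_def[abs_def] by (intro continuous_intros; simp)+

context euclidean_chart
begin

text \<open>An extension of \<open>radial_minus\<close> from the ball of radius \<open>\<rho>\<close> in the chart to the whole manifold, where the chart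
  provides no \<open>|z|\<^sup>2\<close>. Outside of the ball the boundary value \<open>\<rho>\<^sup>2\<close> is used, so that a curve that
  leaves the ball does not gain energy from returning elsewhere.\<close>

definition capped_energy :: "real \<Rightarrow> 'm \<Rightarrow> real" where
  "capped_energy \<rho> m = 2 * sqrt 2 * morse X m - (if m \<in> U \<and> norm (\<phi> m) \<le> \<rho> then (norm (\<phi> m))\<^sup>2 else \<rho>\<^sup>2)"

text \<open>In this form the function is a maximum of two functions that decrease along past timelike curves.\<close>

lemma capped_energy_in_chart:
  assumes "m \<in> U" "0 \<le> \<rho>"
  shows "capped_energy \<rho> m = max (radial_minus (\<phi> m)) (2 * sqrt 2 * morse X m - \<rho>\<^sup>2)"
proof (cases "norm (\<phi> m) \<le> \<rho>")
  case True
  then have "(norm (\<phi> m))\<^sup>2 \<le> \<rho>\<^sup>2" by (intro power_mono) auto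
  then show ?thesis using assms True by (simp add: capped_energy_def radial_minus_def morse_eq power2_norm_eq_inner)
next
  case False
  then have "\<rho>\<^sup>2 \<le> (norm (\<phi> m))\<^sup>2" using assms by (intro power_mono) auto
  then show ?thesis using assms False by (simp add: capped_energy_def radial_minus_def morse_eq power2_norm_eq_inner)
qed

lemma closed_chart_cball:
  assumes "cball 0 \<rho> \<subseteq> \<phi> ` U"
  shows "closed {m \<in> U. norm (\<phi> m) \<le> \<rho>}"
proof -
  have "{m \<in> U. norm (\<phi> m) \<le> \<rho>} = emb ` cball 0 \<rho>"
  proof (intro equalityI subsetI)
    fix m assume "m \<in> {m \<in> U. norm (\<phi> m) \<le> \<rho>}"
    then have "m = emb (\<phi> m)" "\<phi> m \<in> cball 0 \<rho>" by auto
    then show "m \<in> emb ` cball 0 \<rho>" by blast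
  next
    fix m assume "m \<in> emb ` cball 0 \<rho>"
    then obtain y where y: "m = emb y" "y \<in> cball 0 \<rho>" by blast
    then have "y \<in> \<phi> ` U" using assms by blast
    then show "m \<in> {m \<in> U. norm (\<phi> m) \<le> \<rho>}" using y by simp
  qed
  then show ?thesis
    using compact_continuous_image[OF continuous_on_subset[OF continuous_emb assms] compact_cball]
    by (simp add: compact_imp_closed)
qed

lemma open_chart_preimage: "open T \<Longrightarrow> open (U \<inter> \<phi> -` T)"
  by (rule continuous_open_preimage[OF continuous_chart open_U])

lemma capped_energy_decreasing:
  assumes piece: "timelike_piece X (-1) \<gamma> a b" and \<rho>: "0 \<le> \<rho>" "cball 0 \<rho> \<subseteq> \<phi> ` U"
    and st: "a \<le> s" "s \<le> t" "t \<le> b"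
  shows "capped_energy \<rho> (\<gamma> t) \<le> capped_energy \<rho> (\<gamma> s)"
proof -
  have cont: "continuous_on {a..b} \<gamma>" using piece by (simp add: timelike_piece_def)
  let ?P = "\<lambda>u v. s \<le> u \<longrightarrow> u \<le> v \<longrightarrow> v \<le> t \<longrightarrow> capped_energy \<rho> (\<gamma> v) \<le> capped_energy \<rho> (\<gamma> u)"
  have "?P s t"
    using st(2)
  proof (rule Bolzano[where P = ?P], goal_cases)
    case (1 u v w)
    then show ?case by (meson order_trans)
  next
    case (2 x)
    then have xab: "x \<in> {a..b}" using st by auto
    show ?case
    proof (cases "\<gamma> x \<in> U")
      case True
      then obtain d where d: "d > 0" "\<And>u. u \<in> {a..b} \<Longrightarrow> \<bar>u - x\<bar> < d \<Longrightarrow> \<gamma> u \<in> U"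
        using curve_stays[OF cont xab open_U] by blast
      have "capped_energy \<rho> (\<gamma> v) \<le> capped_energy \<rho> (\<gamma> u)"
        if uv: "u \<le> x" "x \<le> v" "v - u < d" "s \<le> u" "v \<le> t" for u v
      proof (cases "u = v")
        case False
        have in_U: "\<gamma> w \<in> U" if "w \<in> {u..v}" for w
          using d(2)[of w] uv st that by auto
        have "radial_minus (\<phi> (\<gamma> v)) < radial_minus (\<phi> (\<gamma> u))"
          by (rule chart_function_decreasing[OF piece _ _ _ in_U radial_minus_has_derivative radial_minus_decreasing])
             (use uv st False in auto)
        moreover have "morse X (\<gamma> v) \<le> morse X (\<gamma> u)"
          by (rule morse_decreasing[OF piece]) (use uv st in auto)
        then have "2 * sqrt 2 * morse X (\<gamma> v) - \<rho>\<^sup>2 \<le> 2 * sqrt 2 * morse X (\<gamma> u) - \<rho>\<^sup>2" by simp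
        ultimately show ?thesis
          using uv by (simp add: capped_energy_in_chart[OF in_U \<rho>(1)] max.coboundedI1 max.coboundedI2)
      qed simp
      then show ?thesis using d(1) by blast
    next
      case False
      let ?W = "- {m \<in> U. norm (\<phi> m) \<le> \<rho>}"
      have "open ?W" using closed_chart_cball[OF \<rho>(2)] by (rule open_Compl)
      then obtain d where d: "d > 0" "\<And>u. u \<in> {a..b} \<Longrightarrow> \<bar>u - x\<bar> < d \<Longrightarrow> \<gamma> u \<in> ?W"
        using curve_stays[OF cont xab, of ?W] False by blast
      have "capped_energy \<rho> (\<gamma> v) \<le> capped_energy \<rho> (\<gamma> u)"
        if uv: "u \<le> x" "x \<le> v" "v - u < d" "s \<le> u" "v \<le> t" for u v
      proof -
        have "morse X (\<gamma> v) \<le> morse X (\<gamma> u)"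
          by (rule morse_decreasing[OF piece]) (use uv st in auto)
        moreover have "\<gamma> u \<in> ?W" "\<gamma> v \<in> ?W" using d(2) uv st by auto
        ultimately show ?thesis by (auto simp: capped_energy_def)
      qed
      then show ?thesis using d(1) by blast
    qed
  qed
  then show ?thesis using st by simp
qed

text \<open>A past curve leaves the trapped region neither through \<open>\<tau> = 0\<close>, as \<open>\<tau>\<close> decreases, nor through the barrier.
  At an exit through the sphere of radius \<open>\<rho>\<close> the capped energy would be \<open>radial_plus - 2 \<rho>\<^sup>2 \<le> d - 2 \<rho>\<^sup>2\<close>,
  contrary to the assumption on the later endpoint. The local version of this statement at each
  parameter is propagated along the curve by Bolzano's principle.\<close>

lemma trapped_invariant:
  assumes piece: "timelike_piece X (-1) \<gamma> a b" and \<rho>: "0 \<le> \<rho>" "cball 0 \<rho> \<subseteq> \<phi> ` U"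
    and start: "\<gamma> a \<in> U" "trapped \<rho> d (\<phi> (\<gamma> a))"
    and capped_energy: "d - 2 * \<rho>\<^sup>2 < capped_energy \<rho> (\<gamma> b)"
  shows "\<gamma> b \<in> U \<and> trapped \<rho> d (\<phi> (\<gamma> b))"
proof -
  have cont: "continuous_on {a..b} \<gamma>" and ab: "a \<le> b" using piece by (auto simp: timelike_piece_def)
  define G where "G u \<longleftrightarrow> \<gamma> u \<in> U \<and> trapped \<rho> d (\<phi> (\<gamma> u))" for u
  have monotone: "radial_plus (\<phi> (\<gamma> v)) < radial_plus (\<phi> (\<gamma> u)) \<and> tau (\<phi> (\<gamma> v)) < tau (\<phi> (\<gamma> u))"
    if "a \<le> u" "u < v" "v \<le> b" "\<And>w. w \<in> {u..v} \<Longrightarrow> \<gamma> w \<in> U" for u v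
    using chart_function_decreasing[OF piece that radial_plus_has_derivative radial_plus_decreasing]
      chart_function_decreasing[OF piece that tau_has_derivative tau_decreasing] by blast
  let ?P = "\<lambda>u v. a \<le> u \<longrightarrow> u \<le> v \<longrightarrow> v \<le> b \<longrightarrow> G u \<longrightarrow> G v"
  have "?P a b"
    using ab
  proof (rule Bolzano[where P = ?P], goal_cases)
    case (1 u v w)
    then show ?case by (meson order_trans)
  next
    case (2 x)
    then have x: "a \<le> x" "x \<le> b" and xab: "x \<in> {a..b}" by auto
    consider (inside) "\<gamma> x \<in> U" "norm (\<phi> (\<gamma> x)) < \<rho>" | (edge) "\<gamma> x \<in> U" "norm (\<phi> (\<gamma> x)) = \<rho>"
      | (outside) "\<not> (\<gamma> x \<in> U \<and> norm (\<phi> (\<gamma> x)) \<le> \<rho>)"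
      by fastforce
    then show ?case
    proof cases
      case outside
      let ?W = "- {m \<in> U. norm (\<phi> m) \<le> \<rho>}"
      have "open ?W" using closed_chart_cball[OF \<rho>(2)] by (rule open_Compl)
      then obtain e where e: "e > 0" "\<And>u. u \<in> {a..b} \<Longrightarrow> \<bar>u - x\<bar> < e \<Longrightarrow> \<gamma> u \<in> ?W"
        using curve_stays[OF cont xab, of ?W] outside by blast
      have "\<not> G u" if "u \<le> x" "x \<le> v" "v - u < e" "a \<le> u" "v \<le> b" for u v
        using e(2)[of u] that by (auto simp: G_def trapped_def)
      then show ?thesis using e(1) by blast
    next
      case edge
      obtain e where e: "e > 0" "\<And>u. u \<in> {a..b} \<Longrightarrow> \<bar>u - x\<bar> < e \<Longrightarrow> \<gamma> u \<in> U"
        using curve_stays[OF cont xab open_U] edge by blast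
      have "\<not> G u" if uv: "u \<le> x" "x \<le> v" "v - u < e" "a \<le> u" "v \<le> b" for u v
      proof
        assume "G u"
        then have "u \<noteq> x" using edge by (auto simp: G_def trapped_def)
        then have "radial_plus (\<phi> (\<gamma> x)) < radial_plus (\<phi> (\<gamma> u))"
          using monotone[of u x] e(2) uv by auto
        then have "radial_plus (\<phi> (\<gamma> x)) \<le> d" using \<open>G u\<close> by (auto simp: G_def trapped_def)
        then have "capped_energy \<rho> (\<gamma> x) \<le> d - 2 * \<rho>\<^sup>2"
          using edge by (simp add: capped_energy_def radial_plus_def morse_eq flip: power2_norm_eq_inner)
        moreover have "capped_energy \<rho> (\<gamma> b) \<le> capped_energy \<rho> (\<gamma> x)"
          by (rule capped_energy_decreasing[OF piece \<rho>]) (use x in auto)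
        ultimately show False using capped_energy by simp
      qed
      then show ?thesis using e(1) by blast
    next
      case inside
      let ?z = "\<phi> (\<gamma> x)"
      obtain e1 where e1: "e1 > 0"
          "\<And>u. u \<in> {a..b} \<Longrightarrow> \<bar>u - x\<bar> < e1 \<Longrightarrow> \<gamma> u \<in> U \<inter> \<phi> -` ball 0 \<rho>"
        using curve_stays[OF cont xab open_chart_preimage[OF open_ball], of 0 \<rho>] inside by auto
      show ?thesis
      proof (cases "0 \<le> barrier_lin ?z \<and> 0 \<le> barrier_quad ?z")
        case False
        have op: "open {z. barrier_lin z < 0 \<or> barrier_quad z < 0}"
          by (intro open_Collect_disj open_Collect_less continuous_on_barrier_lin continuous_on_barrier_quad continuous_on_const)
        have mem: "\<gamma> x \<in> U \<inter> \<phi> -` {z. barrier_lin z < 0 \<or> barrier_quad z < 0}"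
          using inside False by auto
        obtain e2 where e2: "e2 > 0"
          "\<And>u. u \<in> {a..b} \<Longrightarrow> \<bar>u - x\<bar> < e2 \<Longrightarrow> \<gamma> u \<in> U \<inter> \<phi> -` {z. barrier_lin z < 0 \<or> barrier_quad z < 0}"
          using curve_stays[OF cont xab open_chart_preimage[OF op] mem] by blast
        have "G v" if uv: "u \<le> x" "x \<le> v" "v - u < min e1 e2" "a \<le> u" "v \<le> b" and "G u" for u v
        proof (cases "u = v")
          case False
          have "radial_plus (\<phi> (\<gamma> v)) < radial_plus (\<phi> (\<gamma> u)) \<and> tau (\<phi> (\<gamma> v)) < tau (\<phi> (\<gamma> u))"
            by (rule monotone) (use uv False e1(2) in auto)
          moreover have "\<gamma> v \<in> U \<inter> \<phi> -` ball 0 \<rho>" by (rule e1(2)) (use uv in auto)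
          moreover have "\<gamma> v \<in> U \<inter> \<phi> -` {z. barrier_lin z < 0 \<or> barrier_quad z < 0}" by (rule e2(2)) (use uv in auto)
          ultimately show ?thesis using \<open>G u\<close> by (auto simp: G_def trapped_def)
        qed (use \<open>G u\<close> in simp)
        then show ?thesis using e1(1) e2(1) by (intro exI[of _ "min e1 e2"]) auto
      next
        case True
        then have not_G: "\<not> G x" by (auto simp: G_def trapped_def)
        \<comment> \<open>The curve is on the side of \<open>q\<close> at \<open>x\<close>; then it cannot have been trapped shortly before.\<close>
        have "\<exists>e>0. \<forall>u. a \<le> u \<and> u < x \<and> x - u < e \<longrightarrow> \<not> G u"
        proof (cases "tau ?z < 0")
          case False
          have "\<not> G u" if "a \<le> u \<and> u < x \<and> x - u < e1" for u
          proof -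
            have "tau ?z < tau (\<phi> (\<gamma> u))"
              using monotone[of u x] that x e1(2) by auto
            then show ?thesis using False by (auto simp: G_def trapped_def)
          qed
          then show ?thesis using e1(1) by blast
        next
          case tau: True
          then have barrier_lin: "0 < barrier_lin ?z" using True barrier_lin_nonzero[of ?z] by force
          show ?thesis
          proof (cases "barrier_quad ?z = 0")
            case False
            have op: "open {z. 0 < barrier_lin z \<and> 0 < barrier_quad z}"
              by (intro open_Collect_conj open_Collect_less continuous_on_barrier_lin continuous_on_barrier_quad continuous_on_const)
            have mem: "\<gamma> x \<in> U \<inter> \<phi> -` {z. 0 < barrier_lin z \<and> 0 < barrier_quad z}"
              using inside False True barrier_lin by auto
            obtain e2 where e2: "e2 > 0"
              "\<And>u. u \<in> {a..b} \<Longrightarrow> \<bar>u - x\<bar> < e2 \<Longrightarrow> \<gamma> u \<in> U \<inter> \<phi> -` {z. 0 < barrier_lin z \<and> 0 < barrier_quad z}"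
              using curve_stays[OF cont xab open_chart_preimage[OF op] mem] by blast
            have "\<not> G u" if "a \<le> u \<and> u < x \<and> x - u < e2" for u
              using e2(2)[of u] that x by (auto simp: G_def trapped_def)
            then show ?thesis using e2(1) by blast
          next
            case barrier_quad: True
            have op: "open {z. 0 < barrier_lin z}"
              by (intro open_Collect_less continuous_on_barrier_lin continuous_on_const)
            have mem: "\<gamma> x \<in> U \<inter> \<phi> -` {z. 0 < barrier_lin z}"
              using inside barrier_lin by auto
            obtain e2 where e2: "e2 > 0"
              "\<And>u. u \<in> {a..b} \<Longrightarrow> \<bar>u - x\<bar> < e2 \<Longrightarrow> \<gamma> u \<in> U \<inter> \<phi> -` {z. 0 < barrier_lin z}"
              using curve_stays[OF cont xab open_chart_preimage[OF op] mem] by blast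
            have "?z \<noteq> 0" using barrier_lin by (auto simp: barrier_lin_def)
            then have "\<not> critical (atlas X) (morse X) (\<gamma> x)" by (rule not_critical[OF inside(1)])
            then obtain v where v: "((\<phi> \<circ> \<gamma>) has_vector_derivative v) (at x within {a..b})" "timelike_cone (-1) ?z v"
              using timelike_piece_in_chart[OF piece xab inside(1)] by blast
            have "((barrier_quad \<circ> (\<phi> \<circ> \<gamma>)) has_vector_derivative (barrier_grad ?z \<bullet> v)) (at x within {a..b})"
              by (rule has_vector_derivative_compose_has_derivative[OF v(1), of barrier_quad "\<lambda>v. barrier_grad ?z \<bullet> v"])
                 (simp add: barrier_quad_has_derivative)
            then have "((barrier_quad \<circ> (\<phi> \<circ> \<gamma>)) has_real_derivative (barrier_grad ?z \<bullet> v)) (at x within {a..b})"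
              by (simp add: has_real_derivative_iff_has_vector_derivative)
            moreover have "barrier_grad ?z \<bullet> v < 0"
              by (rule barrier_quad_decreasing[OF barrier_quad barrier_lin _ v(2)]) (use tau in simp)
            ultimately obtain e3 where e3: "e3 > 0"
              "\<forall>h>0. x - h \<in> {a..b} \<longrightarrow> h < e3 \<longrightarrow> (barrier_quad \<circ> (\<phi> \<circ> \<gamma>)) x < (barrier_quad \<circ> (\<phi> \<circ> \<gamma>)) (x - h)"
              using has_real_derivative_neg_dec_left by blast
            have "\<not> G u" if u: "a \<le> u \<and> u < x \<and> x - u < min e2 e3" for u
            proof -
              have "0 < barrier_quad (\<phi> (\<gamma> u))"
                using e3(2)[rule_format, of "x - u"] u x barrier_quad by simp
              moreover have "0 < barrier_lin (\<phi> (\<gamma> u))" using e2(2)[of u] u x by auto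
              ultimately show ?thesis by (auto simp: G_def trapped_def)
            qed
            then show ?thesis using e2(1) e3(1) by (intro exI[of _ "min e2 e3"]) auto
          qed
        qed
        then obtain e where e: "e > 0" "\<And>u. a \<le> u \<and> u < x \<and> x - u < e \<Longrightarrow> \<not> G u" by blast
        have "\<not> G u" if "u \<le> x" "x \<le> v" "v - u < e" "a \<le> u" for u v
          using e(2)[of u] not_G that by (cases "u = x") auto
        then show ?thesis using e(1) by blast
      qed
    qed
  qed
  then show ?thesis using ab start by (simp add: G_def)
qed

text \<open>Once the capped energy has dropped to \<open>d - 2 \<rho>\<^sup>2\<close> it does not rise above this value again, so the two alternatives together
  are preserved by every past timelike piece.\<close>

lemma chron_past_subset:
  assumes \<rho>: "0 \<le> \<rho>" "cball 0 \<rho> \<subseteq> \<phi> ` U"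
    and start: "p \<in> U" "trapped \<rho> d (\<phi> p)" and w: "w \<in> chron_past X p"
  shows "w \<in> U \<and> trapped \<rho> d (\<phi> w) \<or> capped_energy \<rho> w \<le> d - 2 * \<rho>\<^sup>2"
proof -
  define B where "B w \<longleftrightarrow> w \<in> U \<and> trapped \<rho> d (\<phi> w) \<or> capped_energy \<rho> w \<le> d - 2 * \<rho>\<^sup>2" for w
  have preserved: "B w" if Bz: "B z" and zw: "joined_by_piece X (-1) z w" for z w
  proof -
    obtain \<gamma> a b where \<gamma>: "timelike_piece X (-1) \<gamma> a b" "\<gamma> a = z" "\<gamma> b = w"
      using zw unfolding joined_by_piece_def by blast
    have ab: "a \<le> b" using \<gamma>(1) by (simp add: timelike_piece_def)
    have le: "capped_energy \<rho> w \<le> capped_energy \<rho> z"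
      using capped_energy_decreasing[OF \<gamma>(1) \<rho> order_refl ab order_refl] \<gamma> by simp
    note inv = trapped_invariant[OF \<gamma>(1) \<rho>, of d, unfolded \<gamma>(2,3)]
    show ?thesis
    proof (cases "capped_energy \<rho> w \<le> d - 2 * \<rho>\<^sup>2")
      case False
      then have "z \<in> U \<and> trapped \<rho> d (\<phi> z)" using Bz le by (auto simp: B_def)
      then show ?thesis using inv False by (simp add: B_def)
    qed (simp add: B_def)
  qed
  have "B p" using start by (simp add: B_def)
  have "(joined_by_piece X (-1))\<^sup>+\<^sup>+ p w" using w by (simp add: chron_past_def)
  then have "B w"
    by (induction rule: tranclp_induct) (use preserved \<open>B p\<close> in blast)+
  then show ?thesis by (simp add: B_def)
qed

end

section \<open>A timelike curve from q to points near p\<close>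

lemma sqrt_2_bounds: "1 < sqrt (2::real)" "sqrt (2::real) < 3 / 2"
proof -
  show "sqrt (2::real) < 3 / 2" by (rule real_less_lsqrt) (simp_all add: power2_eq_square)
qed simp

text \<open>On the plane \<open>x\<^sub>2 = y\<^sub>2 = 0\<close> the functions \<open>f + x\<^sub>1y\<^sub>1\<close> and \<open>f - x\<^sub>1y\<^sub>1\<close> are null coordinates; the
  assumptions say that both increase in the direction \<open>v\<close>.\<close>

lemma timelike_cone_of_null_coordinates:
  assumes plane: "z $ 2 = 0" "z $ 4 = 0" "v $ 2 = 0" "v $ 4 = 0"
    and P: "0 < (z $ 3 - z $ 1) * v $ 1 + (z $ 1 + z $ 3) * v $ 3"
    and M: "0 < - (z $ 1 + z $ 3) * v $ 1 + (z $ 3 - z $ 1) * v $ 3"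
  shows "timelike_cone 1 z v"
proof -
  let ?P = "(z $ 3 - z $ 1) * v $ 1 + (z $ 1 + z $ 3) * v $ 3"
  let ?M = "- (z $ 1 + z $ 3) * v $ 1 + (z $ 3 - z $ 1) * v $ 3"
  have "2 * (grad_f z \<bullet> v)\<^sup>2 - (grad_f z \<bullet> grad_f z) * (v \<bullet> v) = ?P * ?M"
    using plane by (simp add: inner_4 power2_eq_square algebra_simps)
  moreover have "2 * (grad_f z \<bullet> v) = ?P + ?M"
    using plane by (simp add: inner_4 algebra_simps)
  moreover have "0 < ?P * ?M" using P M by (rule mult_pos_pos)
  ultimately show ?thesis using P M unfolding timelike_cone_def by linarith
qed

text \<open>The vectors \<open>axis_a\<close> and \<open>axis_b\<close> are orthogonal axes in the plane, rotated by 22.5 degrees against the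
  coordinate axes. With respect to them the null coordinates are multiples of \<open>b\<^sup>2 - a\<^sup>2\<close> and \<open>-ab\<close>,
  and \<open>q\<close> and \<open>p\<close> lie on the rays \<open>a = b\<close> and \<open>a = -b\<close> with \<open>b > 0\<close>. Along the arc, \<open>a\<close> decreases with unit
  speed and \<open>b\<^sup>2 - a\<^sup>2 = \<epsilon>t\<close> grows slowly, so that it starts in \<open>q\<close> and ends
  close to \<open>p\<close> at \<open>t = 1 + \<surd>2\<close>.\<close>

definition tan_pi_8 :: real where "tan_pi_8 = sqrt 2 - 1"
definition axis_a :: "real^4" where "axis_a = vector [1, 0, - tan_pi_8, 0]"
definition axis_b :: "real^4" where "axis_b = vector [tan_pi_8, 0, 1, 0]"
definition coord_a :: "real \<Rightarrow> real" where "coord_a t = 1 + sqrt 2 / 2 - t"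
definition coord_b :: "real \<Rightarrow> real \<Rightarrow> real" where "coord_b \<epsilon> t = sqrt ((coord_a t)\<^sup>2 + \<epsilon> * t)"
definition arc :: "real \<Rightarrow> real \<Rightarrow> real^4" where
  "arc \<epsilon> t = coord_a t *\<^sub>R axis_a + coord_b \<epsilon> t *\<^sub>R axis_b"
definition arc_velocity :: "real \<Rightarrow> real \<Rightarrow> real^4" where
  "arc_velocity \<epsilon> t = - axis_a + ((\<epsilon> - 2 * coord_a t) / (2 * coord_b \<epsilon> t)) *\<^sub>R axis_b"

lemma tan_pi_8_sq: "tan_pi_8 * tan_pi_8 = 1 - 2 * tan_pi_8"
  by (simp add: tan_pi_8_def algebra_simps)

lemma tan_pi_8_pos: "0 < tan_pi_8"
  by (simp add: tan_pi_8_def)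

lemma coord_b_sq_pos:
  assumes "0 < \<epsilon>" "0 \<le> t" shows "0 < (coord_a t)\<^sup>2 + \<epsilon> * t"
proof (cases "t = 0")
  case True
  have "0 < 1 + sqrt 2 / 2" by (intro add_pos_nonneg) auto
  then show ?thesis using True by (simp add: coord_a_def)
next
  case False
  then show ?thesis using assms by (intro add_nonneg_pos) auto
qed

lemma arc_has_vector_derivative:
  assumes "0 < \<epsilon>" "0 \<le> t"
  shows "(arc \<epsilon> has_vector_derivative arc_velocity \<epsilon> t) (at t within S)"
proof -
  have a: "(coord_a has_real_derivative - 1) (at t within S)"
    unfolding coord_a_def[abs_def] by (auto intro!: derivative_eq_intros)
  have b: "(coord_b \<epsilon> has_real_derivative (\<epsilon> - 2 * coord_a t) / (2 * coord_b \<epsilon> t)) (at t within S)"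
    unfolding coord_b_def[abs_def] using coord_b_sq_pos[OF assms]
    by (auto intro!: derivative_eq_intros a simp: field_simps)
  show ?thesis
    unfolding arc_def[abs_def] arc_velocity_def
    using a b by (auto intro!: derivative_eq_intros simp: has_real_derivative_iff_has_vector_derivative[symmetric])
qed

lemma arc_velocity_continuous: "0 < \<epsilon> \<Longrightarrow> continuous_on {0..c} (arc_velocity \<epsilon>)"
  unfolding arc_velocity_def[abs_def] coord_b_def coord_a_def
  using coord_b_sq_pos[of \<epsilon>] by (intro continuous_intros) (auto simp: coord_a_def less_imp_neq[symmetric])

lemma arc_timelike:
  assumes \<epsilon>: "0 < \<epsilon>" "\<epsilon> \<le> 1 / 2" and t: "0 \<le> t"
  shows "timelike_cone 1 (arc \<epsilon> t) (arc_velocity \<epsilon> t)"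
proof -
  define k \<alpha> \<beta> \<beta>' where "k = tan_pi_8" and "\<alpha> = coord_a t" and "\<beta> = coord_b \<epsilon> t"
    and "\<beta>' = (\<epsilon> - 2 * \<alpha>) / (2 * \<beta>)"
  have k: "k * k + 2 * k - 1 = 0" "0 < k" using tan_pi_8_sq tan_pi_8_pos by (simp_all add: k_def)
  have \<beta>: "0 < \<beta>" "\<beta> * \<beta> = \<alpha> * \<alpha> + \<epsilon> * t"
    using coord_b_sq_pos[OF \<epsilon>(1) t] by (simp_all add: \<alpha>_def \<beta>_def coord_b_def power2_eq_square)
  have \<beta>\<beta>': "\<beta> * \<beta>' = \<epsilon> / 2 - \<alpha>" using \<beta>(1) by (simp add: \<beta>'_def field_simps)
  have z: "arc \<epsilon> t $ 1 = \<alpha> + k * \<beta>" "arc \<epsilon> t $ 2 = 0" "arc \<epsilon> t $ 3 = \<beta> - k * \<alpha>" "arc \<epsilon> t $ 4 = 0"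
    by (simp_all add: arc_def axis_a_def axis_b_def vector_4 k_def \<alpha>_def \<beta>_def)
  have v: "arc_velocity \<epsilon> t $ 1 = - 1 + k * \<beta>'" "arc_velocity \<epsilon> t $ 2 = 0"
    "arc_velocity \<epsilon> t $ 3 = \<beta>' + k" "arc_velocity \<epsilon> t $ 4 = 0"
    by (simp_all add: arc_velocity_def axis_a_def axis_b_def vector_4 k_def \<alpha>_def[symmetric] \<beta>_def[symmetric] \<beta>'_def)
  show ?thesis
  proof (rule timelike_cone_of_null_coordinates)
    have "(arc \<epsilon> t $ 3 - arc \<epsilon> t $ 1) * arc_velocity \<epsilon> t $ 1 + (arc \<epsilon> t $ 1 + arc \<epsilon> t $ 3) * arc_velocity \<epsilon> t $ 3
      = 4 * k * (\<beta> * \<beta>' + \<alpha>) + (k * k + 2 * k - 1) * (\<beta> - \<alpha> * \<beta>' - \<beta> * \<beta>' - \<alpha>)"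
      unfolding z v by (simp add: algebra_simps)
    also have "\<dots> = 2 * k * \<epsilon>" unfolding k \<beta>\<beta>' by simp
    finally show "0 < (arc \<epsilon> t $ 3 - arc \<epsilon> t $ 1) * arc_velocity \<epsilon> t $ 1 + (arc \<epsilon> t $ 1 + arc \<epsilon> t $ 3) * arc_velocity \<epsilon> t $ 3"
      using k(2) \<epsilon>(1) by simp
    have "\<epsilon> * t \<ge> \<epsilon> * (1 - \<alpha>)"
      using \<epsilon>(1) by (simp add: \<alpha>_def coord_a_def)
    moreover have "0 < 2 * (\<alpha> - 3 / 8 * \<epsilon>)\<^sup>2 + \<epsilon> * (1 - 9 / 32 * \<epsilon>)"
      using \<epsilon> by (intro add_nonneg_pos mult_pos_pos) auto
    ultimately have "0 < 2 * (\<alpha> * \<alpha>) + \<epsilon> * t - \<alpha> * \<epsilon> / 2"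
      by (simp add: power2_eq_square algebra_simps)
    also have "\<dots> = \<beta> * (\<beta> - \<alpha> * \<beta>')"
    proof -
      have "\<beta> * (\<beta> - \<alpha> * \<beta>') = \<beta> * \<beta> - \<alpha> * (\<beta> * \<beta>')" by (simp add: algebra_simps)
      then show ?thesis unfolding \<beta>(2) \<beta>\<beta>' by (simp add: algebra_simps)
    qed
    finally have "0 < \<beta> - \<alpha> * \<beta>'" using \<beta>(1) by (simp add: zero_less_mult_iff)
    then have "0 < 4 * k * (\<beta> - \<alpha> * \<beta>') - (k * k + 2 * k - 1) * (\<beta> + \<beta> * \<beta>' + \<alpha> - \<alpha> * \<beta>')"
      using k by simp
    also have "\<dots> = - (arc \<epsilon> t $ 1 + arc \<epsilon> t $ 3) * arc_velocity \<epsilon> t $ 1 + (arc \<epsilon> t $ 3 - arc \<epsilon> t $ 1) * arc_velocity \<epsilon> t $ 3"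
      unfolding z v by (simp add: algebra_simps)
    finally show "0 < - (arc \<epsilon> t $ 1 + arc \<epsilon> t $ 3) * arc_velocity \<epsilon> t $ 1 + (arc \<epsilon> t $ 3 - arc \<epsilon> t $ 1) * arc_velocity \<epsilon> t $ 3" .
  qed (use z v in simp_all)
qed

lemma arc_0: "arc \<epsilon> 0 = q_coord"
proof -
  have b: "coord_b \<epsilon> 0 = 1 + sqrt 2 / 2"
    using sqrt_2_bounds by (simp add: coord_b_def coord_a_def)
  show ?thesis
    by (simp add: vec_eq_iff_4 arc_def b axis_a_def axis_b_def coord_a_def tan_pi_8_def q_coord_def vector_4 field_simps)
qed

lemma arc_end_near_p:
  assumes "0 < \<delta>"
  obtains \<epsilon> where "0 < \<epsilon>" "\<epsilon> \<le> 1 / 2" "dist (arc \<epsilon> (1 + sqrt 2)) p_coord < \<delta>"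
proof -
  have "((\<lambda>\<epsilon>. arc \<epsilon> (1 + sqrt 2)) \<longlongrightarrow> arc 0 (1 + sqrt 2)) (at_right 0)"
    unfolding arc_def coord_b_def by (intro tendsto_intros)
  moreover have "arc 0 (1 + sqrt 2) = p_coord"
  proof -
    have a: "coord_a (1 + sqrt 2) = - (sqrt 2 / 2)" by (simp add: coord_a_def)
    have b: "coord_b 0 (1 + sqrt 2) = sqrt 2 / 2" unfolding coord_b_def a by simp
    show ?thesis
      by (simp add: vec_eq_iff_4 arc_def b axis_a_def axis_b_def a tan_pi_8_def p_coord_def vector_4 field_simps)
  qed
  ultimately have "\<forall>\<^sub>F \<epsilon> in at_right 0. dist (arc \<epsilon> (1 + sqrt 2)) p_coord < \<delta>"
    using assms by (simp add: tendsto_iff)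
  moreover have "\<forall>\<^sub>F \<epsilon> in at_right (0::real). 0 < \<epsilon> \<and> \<epsilon> < 1 / 2"
    using eventually_at_right_real[of 0 "1/2"] by simp
  ultimately have "\<forall>\<^sub>F \<epsilon> in at_right 0. 0 < \<epsilon> \<and> \<epsilon> \<le> 1 / 2 \<and> dist (arc \<epsilon> (1 + sqrt 2)) p_coord < \<delta>"
    by eventually_elim auto
  then show ?thesis using that eventually_happens[of _ "at_right (0::real)"] by (auto simp: trivial_limit_at_right_real)
qed

lemma arc_norm:
  assumes \<epsilon>: "0 < \<epsilon>" "\<epsilon> \<le> 1 / 2" and t: "0 \<le> t" "t \<le> 1 + sqrt 2"
  shows "norm (arc \<epsilon> t) < 3"
proof -
  have s: "sqrt 2 * sqrt 2 = (2::real)" "1 < sqrt (2::real)" "sqrt (2::real) < 3 / 2"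
    using sqrt_2_bounds by simp_all
  have b: "(coord_b \<epsilon> t)\<^sup>2 = (coord_a t)\<^sup>2 + \<epsilon> * t"
    using coord_b_sq_pos[OF \<epsilon>(1) t(1)] by (simp add: coord_b_def)
  have a: "(coord_a t)\<^sup>2 \<le> (1 + sqrt 2 / 2)\<^sup>2"
    by (rule power2_le_iff_abs_le[THEN iffD2]) (use t s in \<open>auto simp: coord_a_def abs_if\<close>)
  have et: "\<epsilon> * t \<le> 1 / 2 * (1 + sqrt 2)"
    using \<epsilon> t by (intro mult_mono) auto
  have "arc \<epsilon> t \<bullet> arc \<epsilon> t = (1 + tan_pi_8 * tan_pi_8) * ((coord_a t)\<^sup>2 + (coord_b \<epsilon> t)\<^sup>2)"
    by (simp add: inner_4 arc_def axis_a_def axis_b_def vector_4 power2_eq_square algebra_simps)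
  also have "\<dots> = (4 - 2 * sqrt 2) * (2 * (coord_a t)\<^sup>2 + \<epsilon> * t)"
    unfolding b tan_pi_8_sq by (simp add: tan_pi_8_def)
  also have "\<dots> \<le> (4 - 2 * sqrt 2) * (7 / 2 + 5 / 2 * sqrt 2)"
  proof (rule mult_left_mono)
    have "(1 + sqrt 2 / 2)\<^sup>2 = 3 / 2 + sqrt 2"
      by (simp add: power2_eq_square field_simps)
    then have "(coord_a t)\<^sup>2 \<le> 3 / 2 + sqrt 2" using a by simp
    then show "2 * (coord_a t)\<^sup>2 + \<epsilon> * t \<le> 7 / 2 + 5 / 2 * sqrt 2" using et by argo
  qed (use s in simp)
  also have "\<dots> = 14 + 3 * sqrt 2 - 5 * (sqrt 2 * sqrt 2)"
  proof -
    have "(4 - 2 * x) * (7 / 2 + 5 / 2 * x) = 14 + 3 * x - 5 * (x * x)" for x :: real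
      by (simp add: field_simps)
    then show ?thesis .
  qed
  also have "\<dots> = 4 + 3 * sqrt 2" unfolding s(1) by simp
  also have "\<dots> < 3\<^sup>2" using s by simp
  finally show ?thesis by (simp add: norm_lt_square)
qed

section \<open>Futures and pasts of p and q\<close>

context euclidean_chart
begin

lemma segment_piece:
  assumes h: "0 < h" and seg: "\<And>t. t \<in> {0..h} \<Longrightarrow> y + t *\<^sub>R u \<in> \<phi> ` U \<and> timelike_cone s (y + t *\<^sub>R u) u"
  shows "joined_by_piece X s (emb y) (emb (y + h *\<^sub>R u))"
proof -
  have "timelike_piece X s (emb \<circ> (\<lambda>t. y + t *\<^sub>R u)) 0 h"
  proof (rule timelike_piece_of_chart_curve[OF h])
    show "((\<lambda>t. y + t *\<^sub>R u) has_vector_derivative u) (at t within {0..h})" for t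
      by (auto intro!: derivative_eq_intros)
  qed (use seg in auto)
  then show ?thesis unfolding joined_by_piece_def by fastforce
qed

lemma arc_piece:
  assumes r: "0 < r" "ball 0 (3 * r) \<subseteq> \<phi> ` U" and \<epsilon>: "0 < \<epsilon>" "\<epsilon> \<le> 1 / 2"
  shows "joined_by_piece X 1 (emb (r *\<^sub>R q_coord)) (emb (r *\<^sub>R arc \<epsilon> (1 + sqrt 2)))"
proof -
  have "timelike_piece X 1 (emb \<circ> (\<lambda>t. r *\<^sub>R arc \<epsilon> t)) 0 (1 + sqrt 2)"
  proof (rule timelike_piece_of_chart_curve)
    show "0 < 1 + sqrt (2::real)" by (intro add_pos_nonneg) auto
    show "r *\<^sub>R arc \<epsilon> t \<in> \<phi> ` U" if "t \<in> {0..1 + sqrt 2}" for t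
      using r arc_norm[OF \<epsilon>, of t] that by (intro subsetD[OF r(2)]) auto
    show "((\<lambda>t. r *\<^sub>R arc \<epsilon> t) has_vector_derivative r *\<^sub>R arc_velocity \<epsilon> t) (at t within {0..1 + sqrt 2})"
      if "t \<in> {0..1 + sqrt 2}" for t
      using arc_has_vector_derivative[OF \<epsilon>(1), of t] that
      by (intro bounded_linear.has_vector_derivative[OF bounded_linear_scaleR_right]) auto
    show "continuous_on {0..1 + sqrt 2} (\<lambda>t. r *\<^sub>R arc_velocity \<epsilon> t)"
      by (intro continuous_intros arc_velocity_continuous \<epsilon>)
    show "timelike_cone 1 (r *\<^sub>R arc \<epsilon> t) (r *\<^sub>R arc_velocity \<epsilon> t)" if "t \<in> {0..1 + sqrt 2}" for t
      using that by (intro timelike_cone_scaleR r arc_timelike \<epsilon>) auto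
  qed
  then show ?thesis unfolding joined_by_piece_def using arc_0 by fastforce
qed

text \<open>The part of the curve near its start is replaced by a straight segment from the given nearby point. Its
  direction is close to the initial velocity of the curve, and timelikeness is an open condition.\<close>

lemma joined_from_nearby:
  assumes joined: "joined_by_piece X s p w" and p: "p \<in> U" "\<phi> p \<noteq> 0"
  obtains \<delta> where "0 < \<delta>" "\<And>y. dist y (\<phi> p) < \<delta> \<Longrightarrow> (joined_by_piece X s)\<^sup>+\<^sup>+ (emb y) w"
proof -
  obtain \<gamma> a b where \<gamma>: "timelike_piece X s \<gamma> a b" "\<gamma> a = p" "\<gamma> b = w"
    using joined unfolding joined_by_piece_def by blast
  have ab: "a < b" and cont: "continuous_on {a..b} \<gamma>" using \<gamma>(1) by (auto simp: timelike_piece_def)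
  have a_in: "a \<in> {a..b}" using ab by simp
  have "\<not> critical (atlas X) (morse X) p" by (rule not_critical[OF p])
  then obtain v where v: "((\<phi> \<circ> \<gamma>) has_vector_derivative v) (at a within {a..b})" "timelike_cone s (\<phi> p) v"
    using timelike_piece_in_chart[OF \<gamma>(1) a_in] \<gamma>(2) p(1) by blast
  obtain d where d: "d > 0" "\<And>z' v'. dist z' (\<phi> p) < d \<Longrightarrow> dist v' v < d \<Longrightarrow> timelike_cone s z' v'"
    using timelike_cone_open[OF v(2)] by blast
  obtain d' where d': "d' > 0" "ball (\<phi> p) d' \<subseteq> \<phi> ` U"
    using openE[OF open_image, of "\<phi> p"] p(1) by blast
  define m where "m = min d d'"
  have m: "m > 0" "m \<le> d" "m \<le> d'" using d(1) d'(1) by (auto simp: m_def)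
  have "\<forall>e>0. \<exists>c>0. \<forall>t\<in>{a..b}. norm (t - a) < c \<longrightarrow>
      norm ((\<phi> \<circ> \<gamma>) t - (\<phi> \<circ> \<gamma>) a - (t - a) *\<^sub>R v) \<le> e * norm (t - a)"
    using v(1) unfolding has_vector_derivative_def has_derivative_within_alt by blast
  from this[rule_format, of "d / 4"] obtain c where c: "c > 0"
    "\<And>t. t \<in> {a..b} \<Longrightarrow> \<bar>t - a\<bar> < c \<Longrightarrow> norm (\<phi> (\<gamma> t) - \<phi> p - (t - a) *\<^sub>R v) \<le> d / 4 * \<bar>t - a\<bar>"
    using d(1) \<gamma>(2) by auto
  have mem: "\<gamma> a \<in> U \<inter> \<phi> -` ball (\<phi> p) m" using m(1) \<gamma>(2) p(1) by simp
  obtain c' where c': "c' > 0"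
    "\<And>t. t \<in> {a..b} \<Longrightarrow> \<bar>t - a\<bar> < c' \<Longrightarrow> \<gamma> t \<in> U \<inter> \<phi> -` ball (\<phi> p) m"
    using curve_stays[OF cont a_in open_chart_preimage[OF open_ball] mem] by blast
  define h where "h = min (min c c') (b - a) / 2"
  have h: "0 < h" "h < c" "h < c'" "h < b - a" using c(1) c'(1) ab by (auto simp: h_def min_def field_simps)
  define t where "t = a + h"
  have t: "t \<in> {a..b}" "a \<le> t" "t < b" "\<bar>t - a\<bar> = h" using h by (auto simp: t_def)
  have \<gamma>t: "\<gamma> t \<in> U" "dist (\<phi> (\<gamma> t)) (\<phi> p) < m" using c'(2)[OF t(1)] t(4) h by (auto simp: dist_commute)
  have "timelike_piece X s \<gamma> t b"
  proof (rule timelike_piece_restrict[OF \<gamma>(1) _ t(2,3)])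
    show "open (fst c)" if "c \<in> atlas X" for c
      using is_chart_open[of "fst c" "snd c"] atlas_is_chart[of "fst c" "snd c"] that by simp
  qed
  then have last: "joined_by_piece X s (\<gamma> t) w" using \<gamma>(3) unfolding joined_by_piece_def by blast
  show ?thesis
  proof (rule that[of "min m (d / 4 * h)"])
    show "0 < min m (d / 4 * h)" using m(1) d(1) h(1) by simp
    fix y assume y: "dist y (\<phi> p) < min m (d / 4 * h)"
    define u where "u = (1 / h) *\<^sub>R (\<phi> (\<gamma> t) - y)"
    have hu: "h *\<^sub>R u = \<phi> (\<gamma> t) - y" using h(1) by (simp add: u_def)
    have "h *\<^sub>R (u - v) = (\<phi> (\<gamma> t) - \<phi> p - h *\<^sub>R v) + (\<phi> p - y)"
      using hu by (simp add: algebra_simps)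
    then have "norm (h *\<^sub>R (u - v)) \<le> norm (\<phi> (\<gamma> t) - \<phi> p - h *\<^sub>R v) + norm (\<phi> p - y)"
      by (simp only: norm_triangle_ineq)
    also have "\<dots> \<le> d / 4 * h + d / 4 * h"
      using c(2)[OF t(1)] t(4) h y by (intro add_mono) (auto simp: t_def dist_norm norm_minus_commute)
    also have "\<dots> < h * d" using h(1) d(1) by simp
    finally have u: "dist u v < d" using h(1) by (simp add: dist_norm)
    have "y + x *\<^sub>R u \<in> ball (\<phi> p) m" if "x \<in> {0..h}" for x
    proof -
      have "y + x *\<^sub>R u = (1 - x / h) *\<^sub>R y + (x / h) *\<^sub>R \<phi> (\<gamma> t)"
        using h(1) by (simp add: u_def algebra_simps)
      moreover have "(1 - x / h) *\<^sub>R y + (x / h) *\<^sub>R \<phi> (\<gamma> t) \<in> ball (\<phi> p) m"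
        by (rule convexD[OF convex_ball]) (use y \<gamma>t(2) that h(1) in \<open>auto simp: dist_commute field_simps\<close>)
      ultimately show ?thesis by simp
    qed
    then have "joined_by_piece X s (emb y) (emb (y + h *\<^sub>R u))"
      by (intro segment_piece h(1) conjI subsetD[OF d'(2)] d(2) u) (use m in \<open>force simp: dist_commute\<close>)+
    then have "joined_by_piece X s (emb y) (\<gamma> t)" using hu \<gamma>t(1) by simp
    then show "(joined_by_piece X s)\<^sup>+\<^sup>+ (emb y) w" using last by (rule tranclp.trancl_into_trancl[OF tranclp.r_into_trancl])
  qed
qed

lemma chron_future_subset:
  assumes r: "0 < r" "ball 0 (3 * r) \<subseteq> \<phi> ` U"
  shows "chron_future X (emb (r *\<^sub>R p_coord)) \<subseteq> chron_future X (emb (r *\<^sub>R q_coord))"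
proof
  let ?p = "emb (r *\<^sub>R p_coord)" and ?q = "emb (r *\<^sub>R q_coord)" and ?J = "joined_by_piece X 1"
  have "p_coord \<bullet> p_coord = 4 - 2 * sqrt 2"
    by (simp add: inner_4 p_coord_def vector_4 algebra_simps)
  also have "\<dots> < 9" using sqrt_2_bounds(1) by linarith
  finally have "p_coord \<bullet> p_coord < 9" .
  then have "norm p_coord < 3" by (simp add: norm_lt_square)
  then have p: "r *\<^sub>R p_coord \<in> \<phi> ` U" using r(1) by (intro subsetD[OF r(2)]) auto
  have p0: "r *\<^sub>R p_coord \<noteq> 0" using r(1) by (simp add: vec_eq_iff_4 p_coord_def vector_4)
  have from_q: "?J\<^sup>+\<^sup>+ ?q z" if pz: "?J ?p z" for z
  proof -
    obtain \<delta> where \<delta>: "0 < \<delta>" "\<And>y. dist y (r *\<^sub>R p_coord) < \<delta> \<Longrightarrow> ?J\<^sup>+\<^sup>+ (emb y) z"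
      using joined_from_nearby[OF pz] p p0 emb_in chart_emb by metis
    obtain \<epsilon> where \<epsilon>: "0 < \<epsilon>" "\<epsilon> \<le> 1 / 2" "dist (arc \<epsilon> (1 + sqrt 2)) p_coord < \<delta> / r"
      using arc_end_near_p[of "\<delta> / r"] \<delta>(1) r(1) by auto
    have "dist (r *\<^sub>R arc \<epsilon> (1 + sqrt 2)) (r *\<^sub>R p_coord) = r * dist (arc \<epsilon> (1 + sqrt 2)) p_coord"
      using r(1) by (simp add: dist_norm flip: scaleR_diff_right)
    also have "\<dots> < \<delta>" using \<epsilon>(3) r(1) by (simp add: field_simps)
    finally show ?thesis
      by (rule tranclp_into_tranclp2[OF arc_piece[OF r \<epsilon>(1,2)] \<delta>(2)])
  qed
  fix w assume "w \<in> chron_future X ?p"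
  then have "?J\<^sup>+\<^sup>+ ?p w" by (simp add: chron_future_def)
  then have "?J\<^sup>+\<^sup>+ ?q w"
  proof (induction rule: tranclp_induct)
    case (base z)
    then show ?case by (rule from_q)
  next
    case (step y z)
    show ?case by (rule tranclp.trancl_into_trancl[OF step.IH step.hyps(2)])
  qed
  then show "w \<in> chron_future X ?q" by (simp add: chron_future_def)
qed

text \<open>The witness is the endpoint of a short segment from \<open>q\<close> in direction \<open>-\<nabla>f\<close>. It is not trapped, being on the
  same side of the barrier as \<open>q\<close>, and its capped energy is close to that of \<open>q\<close>.\<close>

lemma chron_past_not_subset:
  assumes r: "0 < r" "ball 0 (3 * r) \<subseteq> \<phi> ` U"
  shows "\<not> chron_past X (emb (r *\<^sub>R q_coord)) \<subseteq> chron_past X (emb (r *\<^sub>R p_coord))"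
proof
  let ?p = "r *\<^sub>R p_coord" and ?q = "r *\<^sub>R q_coord"
  assume sub: "chron_past X (emb ?q) \<subseteq> chron_past X (emb ?p)"
  have s: "sqrt 2 * sqrt 2 = (2::real)" "1 < sqrt (2::real)" "sqrt (2::real) < 3 / 2"
    using sqrt_2_bounds by simp_all
  \<comment> \<open>The value \<open>d\<close> is \<open>radial_plus\<close> at \<open>rp\<close>. The radius must be less than \<open>3r\<close>, and \<open>d - 2 \<rho>\<^sup>2\<close> less than the
    value \<open>r\<^sup>2 (-8 - 4 \<surd>2)\<close> of \<open>radial_minus\<close> at \<open>rq\<close>, that is, \<open>\<rho>\<^sup>2 > 8 r\<^sup>2\<close>.\<close>
  define \<rho> d where "\<rho> = 29 / 10 * r" and "d = r\<^sup>2 * (8 - 4 * sqrt 2)"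
  have \<rho>: "0 \<le> \<rho>" "cball 0 \<rho> \<subseteq> \<phi> ` U" using r by (auto simp: \<rho>_def)
  have p_nth: "?p $ 1 = r * (1 - sqrt 2)" "?p $ 2 = 0" "?p $ 3 = r" "?p $ 4 = 0"
    and q_nth: "?q $ 1 = r * (sqrt 2 + 1)" "?q $ 2 = 0" "?q $ 3 = r" "?q $ 4 = 0"
    by (simp_all add: p_coord_def q_coord_def vector_4)
  have pp: "?p \<bullet> ?p = r\<^sup>2 * (4 - 2 * sqrt 2)" and qq: "?q \<bullet> ?q = r\<^sup>2 * (4 + 2 * sqrt 2)"
    unfolding inner_4 p_nth q_nth by (simp_all add: power2_eq_square algebra_simps)
  have fp: "anisotropic_f ?p = r\<^sup>2 * (sqrt 2 - 1)" and fq: "anisotropic_f ?q = - (r\<^sup>2 * (1 + sqrt 2))"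
    unfolding anisotropic_f_def p_nth q_nth by (simp_all add: power2_eq_square algebra_simps)
  have norm_less: "norm z < \<rho>" if "z \<bullet> z < r\<^sup>2 * (841 / 100)" for z :: "real^4"
  proof -
    have "z \<bullet> z < \<rho>\<^sup>2" using that by (simp add: \<rho>_def power2_eq_square)
    moreover have "0 < \<rho>" using r(1) by (simp add: \<rho>_def)
    ultimately show ?thesis unfolding norm_lt_square by blast
  qed
  have "r\<^sup>2 * (4 - 2 * sqrt 2) < r\<^sup>2 * (841 / 100)" "r\<^sup>2 * (4 + 2 * sqrt 2) < r\<^sup>2 * (841 / 100)"
    by (rule mult_strict_left_mono; use r(1) s in \<open>(simp; fail) | linarith\<close>)+
  then have norm_p: "norm ?p < \<rho>" and norm_q: "norm ?q < \<rho>"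
    by (auto intro!: norm_less simp only: pp qq)
  have p_in: "?p \<in> \<phi> ` U"
    using norm_p by (auto intro!: subsetD[OF \<rho>(2)])
  have start: "trapped \<rho> d ?p"
  proof -
    have "tau ?p = 0"
      unfolding tau_def fp p_nth by (simp add: power2_eq_square algebra_simps)
    moreover have "radial_plus ?p = d"
      unfolding radial_plus_def fp pp d_def by (simp add: algebra_simps)
    moreover have "barrier_lin ?p < 0"
    proof -
      have "barrier_lin ?p = r * (5 / 6 - sqrt 2)" unfolding barrier_lin_def p_nth by (simp add: algebra_simps)
      moreover have "5 / 6 - sqrt 2 < 0" using s by linarith
      ultimately show ?thesis using mult_pos_neg[OF r(1)] by simp
    qed
    ultimately show ?thesis using norm_p by (simp add: trapped_def)
  qed
  define T where "T = {z. norm z < \<rho> \<and> 0 < barrier_lin z \<and> 0 < barrier_quad z \<and> d - 2 * \<rho>\<^sup>2 < radial_minus z}"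
  have "open T"
    unfolding T_def radial_minus_def anisotropic_f_def inner_4
    by (intro open_Collect_conj open_Collect_less continuous_on_barrier_lin continuous_on_barrier_quad continuous_intros)
  moreover have "?q \<in> T"
  proof -
    have barrier_lin: "barrier_lin ?q = r * (5 / 6 + sqrt 2)" unfolding barrier_lin_def q_nth by (simp add: algebra_simps)
    moreover have "0 < 5 / 6 + sqrt 2" using s by linarith
    ultimately have "0 < barrier_lin ?q" using mult_pos_pos[OF r(1)] by simp
    then have "0 < barrier_quad ?q" unfolding barrier_quad_def q_nth by simp
    note \<open>0 < barrier_lin ?q\<close> this
    moreover note norm_q
    moreover have "d - 2 * \<rho>\<^sup>2 < radial_minus ?q"
    proof -
      have "radial_minus ?q = r\<^sup>2 * (- 8 - 4 * sqrt 2)"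
        unfolding radial_minus_def fq qq by (simp add: algebra_simps)
      moreover have "d - 2 * \<rho>\<^sup>2 = r\<^sup>2 * (8 - 4 * sqrt 2 - 841 / 50)"
        by (simp add: d_def \<rho>_def power2_eq_square algebra_simps)
      ultimately show ?thesis using r(1) by simp
    qed
    ultimately show ?thesis by (simp add: T_def)
  qed
  ultimately obtain e where e: "e > 0" "\<And>z. dist z ?q < e \<Longrightarrow> z \<in> T"
    unfolding open_dist by blast
  let ?g = "grad_f ?q"
  have g: "0 < ?g \<bullet> ?g"
    using r(1) by (simp add: grad_f_scaleR vec_eq_iff_4 q_coord_def vector_4)
  then have "timelike_cone (-1) ?q (- ?g)"
    by (simp add: timelike_cone_def power2_eq_square)
  then obtain c where c: "c > 0" "\<And>z v. dist z ?q < c \<Longrightarrow> dist v (- ?g) < c \<Longrightarrow> timelike_cone (-1) z v"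
    using timelike_cone_open by blast
  define h where "h = min c e / (2 * norm ?g)"
  have norm_g: "0 < norm ?g" using g by (auto simp: norm_eq_sqrt_inner)
  have h: "0 < h" "h * norm ?g < c" "h * norm ?g < e"
    using c(1) e(1) norm_g by (auto simp: h_def min_def)
  have near: "dist (?q + t *\<^sub>R (- ?g)) ?q < min c e" if "t \<in> {0..h}" for t
  proof -
    have "t * norm ?g \<le> h * norm ?g" using that norm_g by simp
    then show ?thesis using h that by (simp add: dist_norm)
  qed
  define y where "y = ?q + h *\<^sub>R (- ?g)"
  have T_image: "z \<in> \<phi> ` U" if "z \<in> T" for z
    using that by (intro subsetD[OF \<rho>(2)]) (simp add: T_def)
  have "joined_by_piece X (-1) (emb ?q) (emb y)"
    unfolding y_def
  proof (rule segment_piece[OF h(1)], intro conjI)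
    fix t assume t: "t \<in> {0..h}"
    show "?q + t *\<^sub>R (- ?g) \<in> \<phi> ` U" using near[OF t] e(2) T_image by simp
    show "timelike_cone (-1) (?q + t *\<^sub>R (- ?g)) (- ?g)" using near[OF t] c by simp
  qed
  then have "emb y \<in> chron_past X (emb ?p)"
    using sub by (auto simp: chron_past_def)
  moreover have "trapped \<rho> d (\<phi> (emb ?p))" using start p_in by simp
  ultimately have dich: "emb y \<in> U \<and> trapped \<rho> d (\<phi> (emb y)) \<or> capped_energy \<rho> (emb y) \<le> d - 2 * \<rho>\<^sup>2"
    using chron_past_subset[OF \<rho>, of "emb ?p" d "emb y"] p_in by simp
  have "y \<in> T" using near[of h] h(1) e(2) by (simp add: y_def)
  then have "\<phi> (emb y) = y" "emb y \<in> U" using T_image by simp_all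
  moreover have "radial_minus y \<le> capped_energy \<rho> (emb y)"
    using capped_energy_in_chart[of "emb y" \<rho>] \<rho>(1) calculation by simp
  ultimately show False
    using dich \<open>y \<in> T\<close> by (auto simp: T_def trapped_def)
qed

lemma not_reflecting_at_scaled:
  assumes "0 < r" "ball 0 (3 * r) \<subseteq> \<phi> ` U"
  shows "\<not> reflecting_at X (emb (r *\<^sub>R p_coord)) (emb (r *\<^sub>R q_coord))"
  using chron_future_subset[OF assms] chron_past_not_subset[OF assms]
  by (simp add: reflecting_at_def)

end

theorem theorem3:
  fixes X :: "('m::{t2_space,second_countable_topology}, real^4) morse_data"
    and U :: "'m set" and \<phi> :: "'m \<Rightarrow> real^4"
    and B :: "('n::{t2_space,second_countable_topology}, 'd::euclidean_space) chart set"
    and k :: "('n, 'd) form_field" and F :: "'n \<Rightarrow> real" and i :: "'m \<Rightarrow> 'n"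
  assumes "compact_morse_spacetime X \<or> euclidean_morse_spacetime X B k F i"
    and "admits_local_chart X (U, \<phi>) euclidean_h anisotropic_f 2"
  shows "\<not> causally_continuous X \<and>
    (ball 0 3 \<subseteq> \<phi> ` U \<longrightarrow>
      points_of_causal_discontinuity X (inv_into U \<phi> p_coord) (inv_into U \<phi> q_coord))"
proof -
  interpret euclidean_chart X U \<phi>
    using assms by unfold_locales (auto simp: compact_morse_spacetime_def euclidean_morse_spacetime_def)
  have "0 \<in> \<phi> ` U"
    using assms(2) unfolding admits_local_chart_def by force
  then obtain e where e: "e > 0" "ball 0 e \<subseteq> \<phi> ` U"
    using open_image openE by blast
  have "\<not> reflecting X"
    using not_reflecting_at_scaled[of "e / 3"] e unfolding reflecting_def by auto
  moreover have "points_of_causal_discontinuity X (emb p_coord) (emb q_coord)" if "ball 0 3 \<subseteq> \<phi> ` U"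
    using not_reflecting_at_scaled[of 1] that by (simp add: points_of_causal_discontinuity_def)
  ultimately show ?thesis by (simp add: causally_continuous_def)
qed

end
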